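(* Whether a central arrangement is totally free or not depends only on its intersection lattice. That is, let $\mathbb{K}$ be a field, and let $\mathcal{A}$ and $\mathcal{B}$ be central arrangements of hyperplanes in finite-dimensional $\mathbb{K}$-vector spaces $V$ and $W$ respectively, each of dimension at least $1$. If the intersection lattices $L(\mathcal{A})$ and $L(\mathcal{B})$ are isomorphic as partially ordered sets, then $\mathcal{A}$ is totally free if and only if $\mathcal{B}$ is totally free.
   Context: A central arrangement in a finite-dimensional $\mathbb{K}$-vector space $V$ of dimension $\ell$ is a finite (possibly empty) collection of linear hyperplanes of $V$. Let $S=\mathrm{Sym}(V^* )\simeq\mathbb{K}[x_1,\ldots,x_\ell]$ for a basis $x_1,\ldots,x_\ell$ of $V^*$, and let $\mathrm{Der}_{\mathbb{K}}(S)=\bigoplus_{i=1}^{\ell}S\,\partial_{x_i}$ be the $S$-module of $\mathbb{K}$-linear derivations of $S$ to itself. For each $H\in\mathcal{A}$ fix $\alpha_H\in V^*$ with $\ker(\alpha_H)=H$. A multiplicity on $\mathcal{A}$ is a function $m:\mathcal{A}\to\mathbb{Z}_{>0}$; the pair $(\mathcal{A},m)$ is called a multiarrangement. Its logarithmic derivation module is $$D(\mathcal{A},m)=\{\theta\in\mathrm{Der}_{\mathbb{K}}(S)\mid \theta(\alpha_H)\in S\cdot\alpha_H^{m(H)}\text{ for all }H\in\mathcal{A}\}.$$ The multiarrangement $(\mathcal{A},m)$ is free if $D(\mathcal{A},m)$ is a free $S$-module. The arrangement $\mathcal{A}$ is totally free if $(\mathcal{A},m)$ is free for every multiplicity $m:\mathcal{A}\to\mathbb{Z}_{>0}$.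 The intersection lattice $L(\mathcal{A})$ is the set $\{H_1\cap\cdots\cap H_s\mid H_i\in\mathcal{A},\ s\ge 0\}$ of all intersections of hyperplanes of $\mathcal{A}$ (the empty intersection being $V$), partially ordered by reverse inclusion. *)

theory Defs
  imports
    Complex_Main
    "HOL-Library.Poly_Mapping"
    "HOL-Library.Function_Algebras"
begin

section \<open>The symmetric algebra and its derivations\<close>

text \<open>
  Once a basis \<open>b\<close> of \<open>V\<close>, indexed by a finite type \<open>'n\<close>, is chosen, \<open>Sym(V\<^sup>*)\<close> is the polynomial
  ring in the coordinates dual to \<open>b\<close>. Types being nonempty, this covers exactly the spaces of
  finite dimension at least \<open>1\<close>. The monomial with exponents \<open>e\<close> is \<open>Poly_Mapping.single e 1\<close>.
\<close>

type_synonym ('n, 'k) sym = "('n \<Rightarrow>\<^sub>0 nat) \<Rightarrow>\<^sub>0 'k"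

definition sym_scale :: "'k::field \<Rightarrow> ('n, 'k) sym \<Rightarrow> ('n, 'k) sym" where
  "sym_scale c f = Poly_Mapping.single 0 c * f"

text \<open>
  The image in \<open>Sym(V\<^sup>*)\<close> of a linear form \<open>\<alpha>\<close>: since \<open>\<alpha> = (\<Sum>i. \<alpha> (b i) \<cdot> x\<^sub>i)\<close> for the basis \<open>x\<close>
  of \<open>V\<^sup>*\<close> dual to \<open>b\<close>, the coefficient of the variable \<open>x\<^sub>i\<close> is \<open>\<alpha> (b i)\<close>.
\<close>

definition sym_of_form :: "('n::finite \<Rightarrow> 'v) \<Rightarrow> ('v \<Rightarrow> 'k::field) \<Rightarrow> ('n, 'k) sym" where
  "sym_of_form b \<alpha> = (\<Sum>i\<in>UNIV. Poly_Mapping.single (Poly_Mapping.single i 1) (\<alpha> (b i)))"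

definition Der :: "(('n::finite, 'k::field) sym \<Rightarrow> ('n, 'k) sym) set" where
  "Der = {\<theta>. Vector_Spaces.linear sym_scale sym_scale \<theta> \<and>
              (\<forall>f g. \<theta> (f * g) = f * \<theta> g + g * \<theta> f)}"

definition der_scale ::
  "('n::finite, 'k::field) sym \<Rightarrow> (('n, 'k) sym \<Rightarrow> ('n, 'k) sym) \<Rightarrow> ('n, 'k) sym \<Rightarrow> ('n, 'k) sym" where
  "der_scale f \<theta> = (\<lambda>g. f * \<theta> g)"

definition free_module :: "('s::comm_ring_1 \<Rightarrow> 'm::ab_group_add \<Rightarrow> 'm) \<Rightarrow> 'm set \<Rightarrow> bool" where
  "free_module scale M \<longleftrightarrow>
     (\<exists>E. \<not> module.dependent scale E \<and> module.span scale E = M)"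


section \<open>Multiarrangements\<close>

text \<open>
  Vector spaces are given by a scalar multiplication on a type, as in the locale
  \<^locale>\<open>vector_space\<close>.
\<close>

definition hyperplane :: "('k::field \<Rightarrow> 'v::ab_group_add \<Rightarrow> 'v) \<Rightarrow> 'v set \<Rightarrow> bool" where
  "hyperplane scale H \<longleftrightarrow>
     module.subspace scale H \<and>
     vector_space.dim scale H + 1 = vector_space.dim scale (UNIV :: 'v set)"

definition central_arrangement ::
  "('k::field \<Rightarrow> 'v::ab_group_add \<Rightarrow> 'v) \<Rightarrow> 'v set set \<Rightarrow> bool" where
  "central_arrangement scale \<A> \<longleftrightarrow> finite \<A> \<and> (\<forall>H\<in>\<A>. hyperplane scale H)"

definition defining_form ::
  "('k::field \<Rightarrow> 'v::ab_group_add \<Rightarrow> 'v) \<Rightarrow> 'v set \<Rightarrow> 'v \<Rightarrow> 'k" where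
  "defining_form scale H =
     (SOME \<alpha>. Vector_Spaces.linear scale (*) \<alpha> \<and> {v. \<alpha> v = 0} = H)"

definition log_derivations ::
  "('k::field \<Rightarrow> 'v::ab_group_add \<Rightarrow> 'v) \<Rightarrow> ('n::finite \<Rightarrow> 'v) \<Rightarrow> 'v set set \<Rightarrow> ('v set \<Rightarrow> nat) \<Rightarrow>
     (('n, 'k) sym \<Rightarrow> ('n, 'k) sym) set" where
  "log_derivations scale b \<A> m =
     {\<theta> \<in> Der. \<forall>H\<in>\<A>. let \<alpha> = sym_of_form b (defining_form scale H) in \<alpha> ^ m H dvd \<theta> \<alpha>}"

definition free_multiarrangement ::
  "('k::field \<Rightarrow> 'v::ab_group_add \<Rightarrow> 'v) \<Rightarrow> ('n::finite \<Rightarrow> 'v) \<Rightarrow> 'v set set \<Rightarrow> ('v set \<Rightarrow> nat) \<Rightarrow> bool" where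
  "free_multiarrangement scale b \<A> m \<longleftrightarrow> free_module der_scale (log_derivations scale b \<A> m)"

definition totally_free ::
  "('k::field \<Rightarrow> 'v::ab_group_add \<Rightarrow> 'v) \<Rightarrow> ('n::finite \<Rightarrow> 'v) \<Rightarrow> 'v set set \<Rightarrow> bool" where
  "totally_free scale b \<A> \<longleftrightarrow>
     (\<forall>m. (\<forall>H\<in>\<A>. m H > 0) \<longrightarrow> free_multiarrangement scale b \<A> m)"


section \<open>The intersection lattice\<close>

text \<open>The empty intersection is \<^term>\<open>\<Inter>{} = (UNIV :: 'v set)\<close>, the whole space.\<close>

definition intersection_lattice :: "'v set set \<Rightarrow> 'v set set" where
  "intersection_lattice \<A> = {\<Inter>\<F> |\<F>. finite \<F> \<and> \<F> \<subseteq> \<A>}"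

definition poset_isomorphic ::
  "'a set \<Rightarrow> ('a \<Rightarrow> 'a \<Rightarrow> bool) \<Rightarrow> 'b set \<Rightarrow> ('b \<Rightarrow> 'b \<Rightarrow> bool) \<Rightarrow> bool" where
  "poset_isomorphic P le\<^sub>P Q le\<^sub>Q \<longleftrightarrow>
     (\<exists>\<phi>. bij_betw \<phi> P Q \<and> (\<forall>x\<in>P. \<forall>y\<in>P. le\<^sub>P x y \<longleftrightarrow> le\<^sub>Q (\<phi> x) (\<phi> y)))"


section \<open>Well-formedness of the encoding\<close>

lemma vector_space_sym_scale:
  "vector_space (sym_scale :: 'k::field \<Rightarrow> ('n, 'k) sym \<Rightarrow> ('n, 'k) sym)"
  by unfold_locales
    (simp_all add: sym_scale_def algebra_simps single_add mult_single flip: mult.assoc)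

lemma module_der_scale:
  "module (der_scale :: ('n::finite, 'k::field) sym \<Rightarrow> _)"
  by unfold_locales (auto simp: der_scale_def algebra_simps)

lemma subspace_log_derivations:
  "module.subspace der_scale (log_derivations scale b \<A> m)"
proof -
  have lin: "Vector_Spaces.linear sym_scale sym_scale \<theta> \<longleftrightarrow>
      (\<forall>f g. \<theta> (f + g) = \<theta> f + \<theta> g) \<and> (\<forall>c f. \<theta> (sym_scale c f) = sym_scale c (\<theta> f))"
    for \<theta> :: "('a, 'b) sym \<Rightarrow> ('a, 'b) sym"
    using vector_space_sym_scale
    by (auto simp: Vector_Spaces.linear_def module_hom_def module_hom_axioms_def
        module_iff_vector_space)
  show ?thesis
    unfolding module.subspace_def[OF module_der_scale] log_derivations_def Der_def lin Let_def
    by (auto simp: der_scale_def sym_scale_def algebra_simps)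
qed

lemma ex_defining_form:
  fixes scale :: "'k::field \<Rightarrow> 'v::ab_group_add \<Rightarrow> 'v"
  assumes "finite_dimensional_vector_space scale B" and "hyperplane scale H"
  shows "\<exists>\<alpha>. Vector_Spaces.linear scale (*) \<alpha> \<and> {v. \<alpha> v = 0} = H"
proof -
  interpret finite_dimensional_vector_space scale B by fact
  interpret K: vector_space "(*) :: 'k \<Rightarrow> 'k \<Rightarrow> 'k"
    by unfold_locales (auto simp: algebra_simps)
  interpret P: vector_space_pair scale "(*) :: 'k \<Rightarrow> 'k \<Rightarrow> 'k" ..
  have sub: "subspace H" and dimH: "dim H + 1 = dim UNIV"
    using assms(2) by (auto simp: hyperplane_def)
  obtain B0 where B0: "B0 \<subseteq> H" "independent B0" "H \<subseteq> span B0" "card B0 = dim H"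
    using basis_exists by blast
  have spB0: "span B0 = H"
    using B0 sub by (simp add: span_minimal subset_antisym)
  define C where "C = extend_basis B0"
  have C: "B0 \<subseteq> C" "independent C" "span C = UNIV"
    using B0(2) by (auto simp: C_def extend_basis_superset independent_extend_basis)
  have finC: "finite C"
    using C(2) by (rule finiteI_independent)
  have cardC: "card C = dim UNIV"
    using dim_eq_card[of C UNIV] C by (metis span_UNIV)
  have "card (C - B0) = 1"
    using C(1) finC cardC dimH B0(4) by (simp add: card_Diff_subset finite_subset)
  then obtain e where e: "C - B0 = {e}"
    by (auto simp: card_1_singleton_iff)
  then have Ce: "C = insert e B0" and enB: "e \<notin> B0" using C(1) by auto
  obtain \<alpha> where lin: "Vector_Spaces.linear scale (*) \<alpha>"
      and \<alpha>: "\<And>x. x \<in> C \<Longrightarrow> \<alpha> x = (if x = e then 1 else 0)"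
    using P.linear_independent_extend[OF C(2), of "\<lambda>x. if x = e then 1 else 0"] by blast
  interpret A: Vector_Spaces.linear scale "(*)" \<alpha> by fact
  have \<alpha>H: "\<alpha> h = 0" if "h \<in> H" for h
  proof (rule A.eq_0_on_span)
    show "h \<in> span B0" using that spB0 by simp
    show "\<alpha> x = 0" if "x \<in> B0" for x
      using \<alpha>[of x] that Ce enB by auto
  qed
  have "v \<in> H" if "\<alpha> v = 0" for v
  proof -
    have "v \<in> span (insert e B0)" using C(3) Ce by simp
    then obtain k where k: "v - scale k e \<in> H"
      using spB0 by (auto simp: span_insert)
    then have "\<alpha> (v - scale k e) = 0" by (rule \<alpha>H)
    then have "k = 0" using that \<alpha>[of e] Ce by (simp add: A.diff A.scale)
    then show ?thesis using k by simp
  qed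
  then show ?thesis using lin \<alpha>H by blast
qed

lemma defining_form:
  assumes "finite_dimensional_vector_space scale B" and "hyperplane scale H"
  shows "Vector_Spaces.linear scale (*) (defining_form scale H)"
    and "{v. defining_form scale H v = 0} = H"
  using someI_ex[OF ex_defining_form[OF assms]] unfolding defining_form_def by blast+

end

theory Submission
  imports Defs
begin

text \<open>
  Call a \<^emph>\<open>long circuit\<close> a set of at least four hyperplanes whose defining forms are linearly
  dependent while any proper subset of them is independent. Dependence of the defining forms can be
  read off the intersection lattice: the form of \<open>H\<close> is a combination of the forms of the members
  of \<open>B\<close> exactly if \<open>\<Inter>B \<subseteq> H\<close>, the hyperplanes are the atoms of the lattice and intersections are its
  joins (\<open>long_circuit_transport\<close>). The theorem follows because an arrangement is totally free
  if and only if it has no long circuit (\<open>totally_free_iff\<close>), over every field.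
  
  A long circuit destroys freeness (\<open>long_circuit_not_free\<close>). In suitable coordinates it consists of
  coordinate hyperplanes \<open>x\<^sub>j = 0\<close> with \<open>j \<in> J\<close>, \<open>\<bar>J\<bar> \<ge> 3\<close>, and of \<open>H\<^sub>0 : \<Sum>\<^sub>j x\<^sub>j = 0\<close>. Give its members the same
  multiplicity \<open>N\<close> and all other hyperplanes multiplicity \<open>1\<close>, and let \<open>Q\<close> be the product of the
  forms of those others. If the logarithmic module \<open>M\<close> were free, the regular sequence
  \<open>x\<^sub>i\<^sup>N, x\<^sub>j\<^sup>N, x\<^sub>k\<^sup>N\<close> would be regular on \<open>M\<close>. The Koszul-type derivations
  \<open>e\<^sub>u\<^sub>v = Q x\<^sub>u\<^sup>N x\<^sub>v\<^sup>N (\<partial>\<^sub>u - \<partial>\<^sub>v)\<close> lie in \<open>M\<close> and satisfy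
  \<open>x\<^sub>k\<^sup>N e\<^sub>i\<^sub>j = x\<^sub>i\<^sup>N e\<^sub>k\<^sub>j + x\<^sub>j\<^sup>N e\<^sub>i\<^sub>k\<close>, so \<open>e\<^sub>i\<^sub>j\<close> would belong to \<open>x\<^sub>i\<^sup>N M + x\<^sub>j\<^sup>N M\<close>. Reading this off at the
  members of the circuit forces \<open>Q\<close> into the ideal generated by the \<open>N\<close>-th powers of their forms,
  which is impossible once \<open>N\<close> exceeds the degree of \<open>Q\<close>.
  
  Without long circuits, the forms of a minimal set of hyperplanes with the same intersection as the
  whole arrangement can be completed to coordinates in which every hyperplane involves at most two
  variables, and the pairs of variables that occur are disjoint. So the arrangement is a product of
  arrangements of rank at most two. For these a basis of the logarithmic module consisting of
  homogeneous elements is constructed by raising one multiplicity at a time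
  (\<open>block_basis_increment\<close>): modulo a linear form in two variables, every binary form of degree \<open>d\<close>
  is a scalar multiple of the \<open>d\<close>-th power of a second linear form, so among the finitely many
  residues that occur the one of least degree divides all the others, and a single elementary
  transformation gives the new basis.
\<close>

section \<open>Polynomials\<close>

definition cst :: "'k::field \<Rightarrow> ('n, 'k) sym" where
  "cst c = Poly_Mapping.single 0 c"

definition var :: "'n \<Rightarrow> ('n, 'k::field) sym" where
  "var i = Poly_Mapping.single (Poly_Mapping.single i 1) 1"

lemma cst_0 [simp]: "cst 0 = 0"
  and cst_1 [simp]: "cst 1 = 1"
  and cst_add: "cst (x + y) = cst x + cst y"
  and cst_mult: "cst (x * y) = cst x * cst y"
  and cst_uminus: "cst (- x) = - cst x"
  by (simp_all add: cst_def single_add single_uminus mult_single)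

lemma cst_power: "cst (x ^ n) = cst x ^ n"
  by (induction n) (simp_all add: cst_mult)

lemma cst_sum: "cst (sum f I) = (\<Sum>i\<in>I. cst (f i))"
  by (induction I rule: infinite_finite_induct) (simp_all add: cst_add)

lemma cst_mult_single: "cst c * Poly_Mapping.single t d = Poly_Mapping.single t (c * d)"
  by (simp add: cst_def mult_single)

lemma lookup_cst_mult [simp]:
  "Poly_Mapping.lookup (cst c * f) t = c * Poly_Mapping.lookup f t"
proof -
  have "cst c * f = Poly_Mapping.map ((*) c) f"
    by (simp add: cst_def mult_map_scale_conv_mult)
  then show ?thesis by (simp add: Poly_Mapping.map.rep_eq when_def)
qed

lemma monomial_expansion:
  "f = (\<Sum>t\<in>Poly_Mapping.keys f. cst (Poly_Mapping.lookup f t) * Poly_Mapping.single t 1)"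
  by (rule poly_mapping_eqI)
    (simp add: cst_mult_single lookup_sum lookup_single when_def in_keys_iff)

lemma polynomial_induct [case_names zero monomial add]:
  fixes f :: "('n, 'k::field) sym"
  assumes "P 0" and "\<And>t c. P (Poly_Mapping.single t c)" and "\<And>f g. P f \<Longrightarrow> P g \<Longrightarrow> P (f + g)"
  shows "P f"
proof -
  have "P (\<Sum>t\<in>T. Poly_Mapping.single t (Poly_Mapping.lookup f t))" for T
    by (induction T rule: infinite_finite_induct) (auto intro: assms)
  from this[of "Poly_Mapping.keys f"] show ?thesis
    using monomial_expansion[of f] by (simp add: cst_mult_single)
qed

text \<open>
  Substitution homomorphisms and derivations are both determined by their values on monomials;
  extending these values linearly reduces each of their laws to a law for monomials.
\<close>

definition mon_extend :: "(('n \<Rightarrow>\<^sub>0 nat) \<Rightarrow> ('p, 'k) sym) \<Rightarrow> ('n, 'k::field) sym \<Rightarrow> ('p, 'k) sym" where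
  "mon_extend \<phi> f = (\<Sum>t\<in>Poly_Mapping.keys f. cst (Poly_Mapping.lookup f t) * \<phi> t)"

lemma mon_extend_superset:
  assumes "finite T" "Poly_Mapping.keys f \<subseteq> T"
  shows "mon_extend \<phi> f = (\<Sum>t\<in>T. cst (Poly_Mapping.lookup f t) * \<phi> t)"
  unfolding mon_extend_def by (rule sum.mono_neutral_left) (use assms in \<open>auto simp: in_keys_iff\<close>)

lemma mon_extend_0 [simp]: "mon_extend \<phi> 0 = 0"
  by (simp add: mon_extend_def)

lemma mon_extend_add: "mon_extend \<phi> (f + g) = mon_extend \<phi> f + mon_extend \<phi> g"
proof -
  let ?T = "Poly_Mapping.keys f \<union> Poly_Mapping.keys g"
  have "mon_extend \<phi> h = (\<Sum>t\<in>?T. cst (Poly_Mapping.lookup h t) * \<phi> t)" if "Poly_Mapping.keys h \<subseteq> ?T" for h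
    using that by (intro mon_extend_superset) auto
  note * = this[of f] this[of g] this[of "f + g"]
  show ?thesis using keys_add[of f g]
    by (simp add: * lookup_add cst_add algebra_simps sum.distrib)
qed

lemma mon_extend_single [simp]: "mon_extend \<phi> (Poly_Mapping.single t c) = cst c * \<phi> t"
  by (simp add: mon_extend_def)

lemma mon_extend_cst_mult: "mon_extend \<phi> (cst c * f) = cst c * mon_extend \<phi> f"
  by (induction f rule: polynomial_induct)
    (simp_all add: cst_mult_single cst_mult distrib_left mon_extend_add mult.assoc)

lemma var_power: "var i ^ k = Poly_Mapping.single (Poly_Mapping.single i k) 1"
  by (induction k) (simp_all add: var_def mult_single flip: single_add)

lemma prod_var_powers:
  "(\<Prod>i\<in>UNIV. var i ^ Poly_Mapping.lookup t i) = (Poly_Mapping.single t 1 :: ('n::finite, 'k::field) sym)"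
proof -
  have "(\<Prod>i\<in>I. var i ^ Poly_Mapping.lookup t i) =
      (Poly_Mapping.single (\<Sum>i\<in>I. Poly_Mapping.single i (Poly_Mapping.lookup t i)) 1 :: ('n, 'k) sym)"
    if "finite I" for I
    using that by (induction I) (simp_all add: var_power mult_single)
  moreover have "(\<Sum>i\<in>UNIV. Poly_Mapping.single i (Poly_Mapping.lookup t i)) = t"
    by (rule poly_mapping_eqI) (simp add: lookup_sum lookup_single when_def cong: if_cong)
  ultimately show ?thesis by simp
qed

subsection \<open>Substitution\<close>

definition subst :: "('n::finite \<Rightarrow> ('p, 'k) sym) \<Rightarrow> ('n, 'k::field) sym \<Rightarrow> ('p, 'k) sym" where
  "subst L = mon_extend (\<lambda>t. \<Prod>i\<in>UNIV. L i ^ Poly_Mapping.lookup t i)"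

lemma subst_0 [simp]: "subst L 0 = 0"
  and subst_add: "subst L (f + g) = subst L f + subst L g"
  and subst_cst [simp]: "subst L (cst c) = cst c"
  by (simp_all add: subst_def mon_extend_add) (simp add: cst_def)

lemma subst_var [simp]: "subst L (var i) = L i"
proof -
  have "(\<Prod>j\<in>UNIV. L j ^ (Poly_Mapping.lookup (Poly_Mapping.single i 1) j)) =
      (\<Prod>j\<in>UNIV. if j = i then L j else 1)"
    by (rule prod.cong) (auto simp: lookup_single when_def)
  then show ?thesis by (simp add: subst_def var_def)
qed

lemma subst_mult: "subst L (f * g) = subst L f * subst L g"
proof (induction f rule: polynomial_induct)
  case (monomial s c)
  show ?case
    by (induction g rule: polynomial_induct)
      (simp_all add: subst_add distrib_left mult_single, simp add: subst_def cst_mult lookup_add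
        power_add prod.distrib algebra_simps)
qed (simp_all add: subst_add distrib_right)

lemma subst_1 [simp]: "subst L 1 = 1"
  using subst_cst[of L 1] by (simp only: cst_1)

lemma subst_power: "subst L (f ^ n) = subst L f ^ n"
  by (induction n) (simp_all add: subst_mult)

lemma subst_sum: "subst L (sum f I) = (\<Sum>i\<in>I. subst L (f i))"
  by (induction I rule: infinite_finite_induct) (simp_all add: subst_add)

lemma subst_prod: "subst L (prod f I) = (\<Prod>i\<in>I. subst L (f i))"
  by (induction I rule: infinite_finite_induct) (simp_all add: subst_mult)

lemma subst_vars [simp]: "subst var f = f"
  by (simp add: subst_def prod_var_powers mon_extend_def flip: monomial_expansion)

lemma subst_subst: "subst L (subst L' f) = subst (\<lambda>i. subst L (L' i)) f"
proof (induction f rule: polynomial_induct)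
  case (monomial t c)
  have "subst L (subst L' (cst c * Poly_Mapping.single t 1)) =
      subst (\<lambda>i. subst L (L' i)) (cst c * Poly_Mapping.single t 1)"
    by (simp only: subst_mult subst_cst prod_var_powers[symmetric] subst_prod subst_power subst_var)
  then show ?case by (simp add: cst_mult_single)
qed (simp_all add: subst_add)

subsection \<open>Derivations\<close>

text \<open>
  If \<open>x\<^sub>i\<close> does not occur in \<open>t\<close>, the subtraction of exponents is truncated, but then the coefficient
  vanishes.
\<close>

definition pderiv_mon :: "'n \<Rightarrow> ('n \<Rightarrow>\<^sub>0 nat) \<Rightarrow> ('n, 'k::field) sym" where
  "pderiv_mon i t = of_nat (Poly_Mapping.lookup t i) * Poly_Mapping.single (t - Poly_Mapping.single i 1) 1"

lemma pderiv_mon_add: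
  "pderiv_mon i (s + t) =
     Poly_Mapping.single s 1 * pderiv_mon i t + Poly_Mapping.single t 1 * pderiv_mon i s"
proof -
  have shift: "of_nat (Poly_Mapping.lookup t i) * Poly_Mapping.single (s + t - Poly_Mapping.single i 1) 1 =
      (of_nat (Poly_Mapping.lookup t i) * (Poly_Mapping.single s 1 *
        Poly_Mapping.single (t - Poly_Mapping.single i 1) 1) :: ('a, 'b) sym)" for s t
  proof (cases "Poly_Mapping.lookup t i = 0")
    case False
    have "s + t - Poly_Mapping.single i 1 = s + (t - Poly_Mapping.single i 1)"
      using False by (intro poly_mapping_eqI) (auto simp: lookup_add lookup_minus lookup_single when_def)
    then show ?thesis by (simp add: mult_single)
  qed simp
  show ?thesis
    using shift[of s t] shift[of t s]
    by (simp add: pderiv_mon_def lookup_add algebra_simps)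
qed

text \<open>
  The derivation \<open>\<Sum>\<^sub>i p\<^sub>i \<partial>\<^sub>i\<close>. By the lemmas below, every derivation is of this form for exactly
  one \<open>p\<close>, so derivations may be replaced by coefficient vectors.
\<close>

definition derivation_of :: "('n::finite \<Rightarrow> ('n, 'k) sym) \<Rightarrow> ('n, 'k::field) sym \<Rightarrow> ('n, 'k) sym" where
  "derivation_of p = mon_extend (\<lambda>t. \<Sum>i\<in>UNIV. p i * pderiv_mon i t)"

lemma linear_sym_scale_iff:
  fixes \<theta> :: "('n, 'k::field) sym \<Rightarrow> ('n, 'k) sym"
  shows
  "Vector_Spaces.linear sym_scale sym_scale \<theta> \<longleftrightarrow>
     (\<forall>f g. \<theta> (f + g) = \<theta> f + \<theta> g) \<and> (\<forall>c f. \<theta> (cst c * f) = cst c * \<theta> f)"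
  using vector_space_sym_scale
  by (auto simp: Vector_Spaces.linear_def module_hom_def module_hom_axioms_def
      module_iff_vector_space sym_scale_def cst_def)

lemma derivation_of_var [simp]: "derivation_of p (var i) = p i"
proof -
  have "p j * pderiv_mon j (Poly_Mapping.single i 1) = (if j = i then p j else 0)" for j
    by (simp add: pderiv_mon_def lookup_single when_def)
  then show ?thesis by (simp add: derivation_of_def var_def)
qed

lemma derivation_of_add: "derivation_of p (f + g) = derivation_of p f + derivation_of p g"
  and derivation_of_cst_mult: "derivation_of p (cst c * f) = cst c * derivation_of p f"
  and derivation_of_0 [simp]: "derivation_of p 0 = 0"
  by (simp_all add: derivation_of_def mon_extend_add mon_extend_cst_mult)

lemma derivation_of_mult:
  "derivation_of p (f * g) = f * derivation_of p g + g * derivation_of p f"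
proof (induction f rule: polynomial_induct)
  case (monomial s c)
  show ?case
  proof (induction g rule: polynomial_induct)
    case (monomial t d)
    let ?m = "\<lambda>u. Poly_Mapping.single u 1 :: ('a, 'b) sym"
    have mons: "derivation_of p (?m s * ?m t) = ?m s * derivation_of p (?m t) + ?m t * derivation_of p (?m s)"
      by (simp add: derivation_of_def mult_single pderiv_mon_add distrib_left sum.distrib
          sum_distrib_left mult.left_commute)
    have "derivation_of p ((cst c * ?m s) * (cst d * ?m t)) =
        derivation_of p (cst c * (cst d * (?m s * ?m t)))"
      by (simp only: ac_simps)
    also have "\<dots> = (cst c * ?m s) * (cst d * derivation_of p (?m t)) +
        (cst d * ?m t) * (cst c * derivation_of p (?m s))"
      by (simp only: derivation_of_cst_mult mons distrib_left ac_simps)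
    finally show ?case
      by (simp only: derivation_of_cst_mult[symmetric]) (simp add: cst_mult_single)
  qed (simp_all add: derivation_of_add distrib_left distrib_right ac_simps)
qed (simp_all add: derivation_of_add distrib_left distrib_right ac_simps)

lemma derivation_of_in_Der: "derivation_of p \<in> Der"
  using derivation_of_mult derivation_of_add derivation_of_cst_mult
  unfolding Der_def linear_sym_scale_iff by blast

lemma DerD:
  assumes "\<theta> \<in> Der"
  shows "\<theta> (f + g) = \<theta> f + \<theta> g" "\<theta> (cst c * f) = cst c * \<theta> f" "\<theta> (f * g) = f * \<theta> g + g * \<theta> f"
  using assms by (auto simp: Der_def linear_sym_scale_iff)

lemma Der_sum:
  assumes "\<theta> \<in> Der"
  shows "\<theta> (sum f I) = (\<Sum>i\<in>I. \<theta> (f i))"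
proof -
  have "\<theta> 0 = 0" using DerD(1)[OF assms, of 0 0] by simp
  then show ?thesis
    by (induction I rule: infinite_finite_induct) (simp_all add: DerD(1)[OF assms])
qed

lemma Der_eqI:
  fixes \<theta> :: "('n::finite, 'k::field) sym \<Rightarrow> ('n, 'k) sym"
  assumes \<theta>: "\<theta> \<in> Der" and \<theta>': "\<theta>' \<in> Der" and eq: "\<And>i. \<theta> (var i) = \<theta>' (var i)"
  shows "\<theta> = \<theta>'"
proof
  fix f :: "('n, 'k) sym"
  let ?E = "\<lambda>f. \<theta> f = \<theta>' f"
  have mult: "?E (f * g)" if "?E f" "?E g" for f g
    using that by (simp add: DerD(3)[OF \<theta>] DerD(3)[OF \<theta>'])
  have one: "\<rho> 1 = 0" if "\<rho> \<in> Der" for \<rho> :: "('n, 'k) sym \<Rightarrow> ('n, 'k) sym"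
    using DerD(3)[OF that, of 1 1] by simp
  have "?E (var i ^ n)" for i n
    by (induction n) (auto simp: one \<theta> \<theta>' intro: mult eq)
  then have "?E (\<Prod>i\<in>I. var i ^ Poly_Mapping.lookup t i)" for I t
    by (induction I rule: infinite_finite_induct) (auto simp: one \<theta> \<theta>' intro: mult)
  from this[where I = UNIV] have "?E (cst c * Poly_Mapping.single t 1)" for c t
    by (simp add: prod_var_powers DerD(2)[OF \<theta>] DerD(2)[OF \<theta>'])
  then have "?E (Poly_Mapping.single t c)" for t c
    by (simp add: cst_mult_single)
  then show "?E f"
  proof (induction f rule: polynomial_induct)
    case zero
    show ?case using Der_sum[OF \<theta>, of "\<lambda>x. x" "{}"] Der_sum[OF \<theta>', of "\<lambda>x. x" "{}"] by simp
  qed (simp_all add: DerD(1)[OF \<theta>] DerD(1)[OF \<theta>'])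
qed

section \<open>Logarithmic derivations in coordinates\<close>

definition vscale :: "'s::comm_ring_1 \<Rightarrow> ('n \<Rightarrow> 's) \<Rightarrow> 'n \<Rightarrow> 's" where
  "vscale f p = (\<lambda>i. f * p i)"

lemma module_vscale: "module vscale"
  by unfold_locales (auto simp: vscale_def algebra_simps)

definition form_at :: "('n::finite \<Rightarrow> 'k::field) \<Rightarrow> ('n \<Rightarrow> ('p, 'k) sym) \<Rightarrow> ('p, 'k) sym" where
  "form_at a p = (\<Sum>i\<in>UNIV. cst (a i) * p i)"

abbreviation linform :: "('n::finite \<Rightarrow> 'k::field) \<Rightarrow> ('n, 'k) sym" where
  "linform a \<equiv> form_at a var"

lemma form_at_add: "form_at a (\<lambda>i. p i + q i) = form_at a p + form_at a q"
  and form_at_vscale: "form_at a (vscale f p) = f * form_at a p"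
  and form_at_sum: "form_at a (\<lambda>i. \<Sum>k\<in>K. r k i) = (\<Sum>k\<in>K. form_at a (r k))"
  by (simp_all add: form_at_def vscale_def distrib_left sum.distrib
      sum_distrib_left mult.left_commute sum.swap[of _ K])

text \<open>
  The coefficient vectors of the logarithmic derivations. The row \<open>a H\<close> holds the coordinates of a
  defining form of \<open>H\<close>, so that \<open>form_at (a H) p\<close> is the value at that form of the derivation with
  coefficients \<open>p\<close>. The hyperplanes themselves serve as labels only.
\<close>

definition log_vectors ::
  "('h \<Rightarrow> 'n::finite \<Rightarrow> 'k::field) \<Rightarrow> 'h set \<Rightarrow> ('h \<Rightarrow> nat) \<Rightarrow> ('n \<Rightarrow> ('n, 'k) sym) set" where
  "log_vectors a A m = {p. \<forall>H\<in>A. linform (a H) ^ m H dvd form_at (a H) p}"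

text \<open>
  The map is allowed to be semilinear because a change of basis of the vector space acts on the polynomial
  ring, too, by a linear substitution.
\<close>

lemma free_module_transfer:
  fixes s1 :: "'r::comm_ring_1 \<Rightarrow> 'a::ab_group_add \<Rightarrow> 'a"
    and s2 :: "'s::comm_ring_1 \<Rightarrow> 'b::ab_group_add \<Rightarrow> 'b"
  assumes "module s1" "module s2"
    and \<tau>: "surj \<tau>" "\<tau> 0 = 0"
    and add: "\<And>x y. \<Psi> (x + y) = \<Psi> x + \<Psi> y"
    and scale: "\<And>f x. \<Psi> (s1 f x) = s2 (\<tau> f) (\<Psi> x)"
    and inj: "inj_on \<Psi> M" and free: "free_module s1 M"
  shows "free_module s2 (\<Psi> ` M)"
proof -
  interpret M1: module s1 by fact
  interpret M2: module s2 by fact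
  have zero: "\<Psi> 0 = 0" using add[of 0 0] by simp
  have sum: "\<Psi> (\<Sum>a\<in>t. s1 (r a) a) = (\<Sum>a\<in>t. s2 (\<tau> (r a)) (\<Psi> a))" for t r
    by (induction t rule: infinite_finite_induct) (simp_all add: zero add scale)
  obtain E where E: "M1.independent E" "M1.span E = M"
    using free by (auto simp: free_module_def)
  have injE: "inj_on \<Psi> E"
    using inj E(2) M1.span_superset by (metis inj_on_subset)
  have lift: "\<exists>r. \<forall>a\<in>t. u (\<Psi> a) = \<tau> (r a)" for u t
    using \<tau>(1) by (intro exI[of _ "\<lambda>a. inv \<tau> (u (\<Psi> a))"]) (simp add: surj_f_inv_f)
  have ind: "M2.independent (\<Psi> ` E)"
  proof
    assume "M2.dependent (\<Psi> ` E)"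
    then obtain t u v where t: "finite t" "t \<subseteq> \<Psi> ` E" "(\<Sum>v\<in>t. s2 (u v) v) = 0" "v \<in> t" "u v \<noteq> 0"
      by (auto simp: M2.dependent_explicit)
    obtain t' where t': "t' \<subseteq> E" "t = \<Psi> ` t'" using t(2) by (auto simp: subset_image_iff)
    have inj': "inj_on \<Psi> t'" using injE t'(1) by (rule inj_on_subset)
    have fin: "finite t'" using t(1) t'(2) inj' by (simp add: finite_image_iff)
    obtain r where r: "\<And>a. a \<in> t' \<Longrightarrow> u (\<Psi> a) = \<tau> (r a)" using lift[of t' u] by blast
    let ?x = "\<Sum>a\<in>t'. s1 (r a) a"
    have "\<Psi> ?x = \<Psi> 0"
      using t(3) by (simp add: t'(2) sum.reindex[OF inj'] sum zero r)
    moreover have "?x \<in> M1.span E"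
      using t'(1) by (intro M1.span_sum M1.span_scale M1.span_base) auto
    then have "?x \<in> M" "0 \<in> M" using M1.span_zero[of E] by (simp_all add: E(2))
    ultimately have "?x = 0" using inj by (auto simp: inj_on_def)
    then have "r a = 0" if "a \<in> t'" for a
      using E(1) fin t'(1) that by (auto simp: M1.dependent_explicit)
    then show False using t(4,5) t'(2) r \<tau>(2) by auto
  qed
  have "M2.span (\<Psi> ` E) = \<Psi> ` M"
  proof (intro equalityI subsetI)
    fix y assume "y \<in> M2.span (\<Psi> ` E)"
    then obtain t u where t: "finite t" "t \<subseteq> \<Psi> ` E" "y = (\<Sum>v\<in>t. s2 (u v) v)"
      by (auto simp: M2.span_explicit)
    obtain t' where t': "t' \<subseteq> E" "t = \<Psi> ` t'" using t(2) by (auto simp: subset_image_iff)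
    have inj': "inj_on \<Psi> t'" using injE t'(1) by (rule inj_on_subset)
    obtain r where r: "\<And>a. a \<in> t' \<Longrightarrow> u (\<Psi> a) = \<tau> (r a)" using lift[of t' u] by blast
    have "y = \<Psi> (\<Sum>a\<in>t'. s1 (r a) a)"
      by (simp add: t(3) t'(2) sum.reindex[OF inj'] sum r)
    moreover have "(\<Sum>a\<in>t'. s1 (r a) a) \<in> M1.span E"
      using t'(1) by (intro M1.span_sum M1.span_scale M1.span_base) auto
    ultimately show "y \<in> \<Psi> ` M" by (auto simp: E(2))
  next
    fix y assume "y \<in> \<Psi> ` M"
    then obtain t r where "t \<subseteq> E" and y: "y = \<Psi> (\<Sum>a\<in>t. s1 (r a) a)"
      by (auto simp flip: E(2) simp: M1.span_explicit)
    then show "y \<in> M2.span (\<Psi> ` E)"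
      unfolding y sum by (intro M2.span_sum M2.span_scale M2.span_base) auto
  qed
  then show ?thesis using ind by (auto simp: free_module_def)
qed

lemma Der_form_at:
  assumes "\<theta> \<in> Der"
  shows "\<theta> (linform a) = form_at a (\<lambda>i. \<theta> (var i))"
  by (simp add: form_at_def Der_sum[OF assms] DerD(2)[OF assms])

lemma sym_of_form_eq: "sym_of_form b \<alpha> = linform (\<lambda>i. \<alpha> (b i))"
  by (simp add: sym_of_form_def form_at_def var_def cst_mult_single)

text \<open>
  Evaluation at the variables identifies derivations with coefficient vectors and maps
  logarithmic derivations onto logarithmic vectors.
\<close>

lemma free_multiarrangement_coordinates:
  fixes scale :: "'k::field \<Rightarrow> 'v::ab_group_add \<Rightarrow> 'v" and b :: "'n::finite \<Rightarrow> 'v"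
  shows "free_multiarrangement scale b \<A> m \<longleftrightarrow>
    free_module vscale (log_vectors (\<lambda>H i. defining_form scale H (b i)) \<A> m)"
    (is "_ \<longleftrightarrow> free_module vscale ?M")
proof -
  let ?D = "log_derivations scale b \<A> m"
  let ?ev = "\<lambda>\<theta> :: ('n, 'k) sym \<Rightarrow> ('n, 'k) sym. \<lambda>i. \<theta> (var i)"
  have evM: "?ev \<theta> \<in> ?M" if "\<theta> \<in> ?D" for \<theta>
    using that by (auto simp: log_derivations_def log_vectors_def sym_of_form_eq Der_form_at Let_def)
  have derD: "derivation_of p \<in> ?D" if "p \<in> ?M" for p
    using that derivation_of_in_Der[of p]
    by (auto simp: log_derivations_def log_vectors_def sym_of_form_eq Der_form_at Let_def)
  have ev_der: "?ev (derivation_of p) = p" for p by simp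
  have der_ev: "derivation_of (?ev \<theta>) = \<theta>" if "\<theta> \<in> ?D" for \<theta>
    using that by (intro Der_eqI derivation_of_in_Der) (auto simp: log_derivations_def)
  have M: "?M = ?ev ` ?D"
    using evM derD by (auto intro!: rev_image_eqI[OF derD] simp: ev_der)
  have D: "?D = derivation_of ` ?M"
    using derD by (auto intro!: rev_image_eqI[OF evM] simp: der_ev)
  have "free_module vscale ?M" if "free_module der_scale ?D"
    unfolding M
    by (rule free_module_transfer[OF module_der_scale module_vscale, of "\<lambda>f. f"])
      (use that der_ev in \<open>auto simp: der_scale_def vscale_def intro: inj_on_inverseI\<close>)
  moreover have "free_module der_scale ?D" if "free_module vscale ?M"
    unfolding D
    by (rule free_module_transfer[OF module_vscale module_der_scale, of "\<lambda>f. f"])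
      (use that ev_der in \<open>auto simp: der_scale_def vscale_def derivation_of_def mon_extend_def fun_eq_iff
          distrib_left distrib_right sum.distrib sum_distrib_left mult.assoc mult.left_commute
        intro: inj_on_inverseI[where g = ?ev]\<close>)
  ultimately show ?thesis by (auto simp: free_multiarrangement_def)
qed

subsection \<open>Change of basis\<close>

text \<open>
  This is \<open>\<theta> \<mapsto> T \<circ> \<theta> \<circ> T\<^sup>-\<^sup>1\<close> in terms of coefficient vectors, where the substitution \<open>T\<close> expresses
  the old variables by the new ones through the matrix \<open>G\<close>; the coefficients with respect to the new
  partial derivatives arise through the inverse matrix \<open>G'\<close>.
\<close>

definition base_change ::
  "('n::finite \<Rightarrow> 'n \<Rightarrow> 'k::field) \<Rightarrow> ('n \<Rightarrow> 'n \<Rightarrow> 'k) \<Rightarrow> ('n \<Rightarrow> ('n, 'k) sym) \<Rightarrow> 'n \<Rightarrow> ('n, 'k) sym" where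
  "base_change G G' q = (\<lambda>i. form_at (G' i) (\<lambda>j. subst (\<lambda>j. linform (G j)) (q j)))"

definition inverse_matrices :: "('n::finite \<Rightarrow> 'n \<Rightarrow> 'k::field) \<Rightarrow> ('n \<Rightarrow> 'n \<Rightarrow> 'k) \<Rightarrow> bool" where
  "inverse_matrices G G' \<longleftrightarrow> (\<forall>i k. (\<Sum>j\<in>UNIV. G i j * G' j k) = (if i = k then 1 else 0))"

lemma form_at_form_at:
  "form_at a (\<lambda>i. form_at (G i) p) = form_at (\<lambda>j. \<Sum>i\<in>UNIV. a i * G i j) p"
  by (simp add: form_at_def sum_distrib_left sum_distrib_right cst_sum cst_mult mult.assoc)
    (rule sum.swap)

lemma form_at_inverse:
  assumes "inverse_matrices G G'"
  shows "form_at (G i) (\<lambda>j. form_at (G' j) p) = p i"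
proof -
  have "form_at (G i) (\<lambda>j. form_at (G' j) p) = (\<Sum>k\<in>UNIV. cst (if i = k then 1 else 0) * p k)"
    using assms by (simp add: form_at_form_at inverse_matrices_def) (simp add: form_at_def)
  also have "\<dots> = (\<Sum>k\<in>UNIV. if k = i then p k else 0)"
    by (rule sum.cong) auto
  finally show ?thesis by simp
qed

lemma subst_form_at: "subst L (form_at a p) = form_at a (\<lambda>i. subst L (p i))"
  by (simp add: form_at_def subst_sum subst_mult)

lemma subst_inverse:
  assumes "inverse_matrices G G'"
  shows "subst (\<lambda>j. linform (G' j)) (subst (\<lambda>j. linform (G j)) f) = f"
  by (simp add: subst_subst subst_form_at form_at_inverse[OF assms])

lemma base_change_inverse:
  assumes "inverse_matrices G G'"
  shows "base_change G' G (base_change G G' q) = q"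
  by (simp add: base_change_def subst_form_at subst_inverse[OF assms] form_at_inverse[OF assms])

lemma base_change_log_vectors:
  assumes G: "inverse_matrices G G'" and p: "p \<in> log_vectors a A m"
  shows "base_change G G' p \<in> log_vectors (\<lambda>H i. \<Sum>j\<in>UNIV. a H j * G j i) A m"
proof -
  let ?T = "subst (\<lambda>j. linform (G j))"
  let ?a = "\<lambda>H i. \<Sum>j\<in>UNIV. a H j * G j i"
  have "form_at (?a H) (base_change G G' p) = ?T (form_at (a H) p)" for H
    by (simp add: base_change_def subst_form_at form_at_inverse[OF G] flip: form_at_form_at)
  moreover have "linform (?a H) = ?T (linform (a H))" for H
    by (simp add: subst_form_at form_at_form_at)
  moreover have "?T f dvd ?T g" if "f dvd g" for f g
    using that by (auto simp: dvd_def subst_mult)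
  ultimately show ?thesis
    using p by (simp add: log_vectors_def flip: subst_power)
qed

lemma free_log_vectors_base_change:
  assumes G: "inverse_matrices G G'" and G': "inverse_matrices G' G"
    and free: "free_module vscale (log_vectors a A m)"
  shows "free_module vscale (log_vectors (\<lambda>H i. \<Sum>j\<in>UNIV. a H j * G j i) A m)"
    (is "free_module vscale (log_vectors ?a A m)")
proof -
  let ?\<Psi> = "base_change G G'"
  have inv_mem: "base_change G' G p \<in> log_vectors a A m" if "p \<in> log_vectors ?a A m" for p
  proof -
    have "(\<Sum>j\<in>UNIV. ?a H j * G' j i) = a H i" for H i
    proof -
      have "(\<Sum>j\<in>UNIV. ?a H j * G' j i) = (\<Sum>k\<in>UNIV. a H k * (\<Sum>j\<in>UNIV. G k j * G' j i))"
        by (simp add: sum_distrib_left sum_distrib_right mult.assoc) (rule sum.swap)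
      also have "\<dots> = (\<Sum>k\<in>UNIV. if k = i then a H k else 0)"
        using G by (intro sum.cong) (auto simp: inverse_matrices_def)
      finally show ?thesis by simp
    qed
    then show ?thesis using base_change_log_vectors[OF G' that] by simp
  qed
  have "log_vectors ?a A m = ?\<Psi> ` log_vectors a A m"
  proof (intro equalityI subsetI)
    fix p assume "p \<in> log_vectors ?a A m"
    then show "p \<in> ?\<Psi> ` log_vectors a A m"
      by (rule rev_image_eqI[OF inv_mem]) (simp add: base_change_inverse[OF G'])
  qed (use base_change_log_vectors[OF G] in auto)
  moreover have "free_module vscale (?\<Psi> ` log_vectors a A m)"
  proof (rule free_module_transfer[OF module_vscale module_vscale _ _ _ _ _ free])
    show "surj (subst (\<lambda>j. linform (G j)))"
      by (rule surjI) (rule subst_inverse[OF G'])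
    show "inj_on ?\<Psi> (log_vectors a A m)"
      by (rule inj_on_inverseI) (rule base_change_inverse[OF G])
    show "?\<Psi> (vscale f p) = vscale (subst (\<lambda>j. linform (G j)) f) (?\<Psi> p)" for f p
      by (simp add: base_change_def fun_eq_iff vscale_def subst_mult form_at_def sum_distrib_left
          mult.left_commute)
  qed (simp_all add: base_change_def fun_eq_iff subst_add form_at_add)
  ultimately show ?thesis by simp
qed

section \<open>Homogeneous polynomials and regular sequences\<close>

definition mon_deg :: "('n::finite \<Rightarrow>\<^sub>0 nat) \<Rightarrow> nat" where
  "mon_deg t = (\<Sum>i\<in>UNIV. Poly_Mapping.lookup t i)"

lemma mon_deg_0 [simp]: "mon_deg 0 = 0"
  and mon_deg_add: "mon_deg (s + t) = mon_deg s + mon_deg t"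
  and mon_deg_single [simp]: "mon_deg (Poly_Mapping.single i k) = k"
  by (simp_all add: mon_deg_def lookup_add sum.distrib lookup_single when_def)

text \<open>
  Forms in a subset of the variables are singled out inside the full polynomial ring, which avoids
  passing between polynomial rings in different sets of variables.
\<close>

definition forms :: "'n set \<Rightarrow> nat \<Rightarrow> ('n::finite, 'k::field) sym set" where
  "forms B d = {f. \<forall>t\<in>Poly_Mapping.keys f. Poly_Mapping.keys t \<subseteq> B \<and> mon_deg t = d}"

lemma forms_0 [simp]: "0 \<in> forms B d"
  by (simp add: forms_def)

lemma forms_add: "f \<in> forms B d \<Longrightarrow> g \<in> forms B d \<Longrightarrow> f + g \<in> forms B d"
  using keys_add[of f g] by (auto simp: forms_def)

lemma forms_sum: "(\<And>i. i \<in> I \<Longrightarrow> f i \<in> forms B d) \<Longrightarrow> sum f I \<in> forms B d"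
  by (induction I rule: infinite_finite_induct) (auto intro: forms_add)

lemma forms_mult:
  assumes "f \<in> forms B d" "g \<in> forms B e"
  shows "f * g \<in> forms B (d + e)"
  unfolding forms_def
proof (intro CollectI ballI)
  fix u assume "u \<in> Poly_Mapping.keys (f * g)"
  then obtain s t where st: "s \<in> Poly_Mapping.keys f" "t \<in> Poly_Mapping.keys g" "u = s + t"
    using keys_mult[of f g] by blast
  moreover from st assms have "Poly_Mapping.keys s \<subseteq> B" "mon_deg s = d"
      "Poly_Mapping.keys t \<subseteq> B" "mon_deg t = e"
    by (auto simp: forms_def)
  ultimately show "Poly_Mapping.keys u \<subseteq> B \<and> mon_deg u = d + e"
    using keys_add[of s t] by (auto simp: mon_deg_add)
qed

lemma forms_cst [simp]: "cst c \<in> forms B 0"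
  by (auto simp: forms_def cst_def)

lemma forms_1 [simp]: "1 \<in> forms B 0"
  using forms_cst[of 1 B] by (simp only: cst_1)

lemma forms_cst_mult: "f \<in> forms B d \<Longrightarrow> cst c * f \<in> forms B d"
  using forms_mult[OF forms_cst] by simp

lemma forms_var: "i \<in> B \<Longrightarrow> var i \<in> forms B 1"
  by (auto simp: forms_def var_def)

lemma forms_power: "f \<in> forms B d \<Longrightarrow> f ^ n \<in> forms B (n * d)"
  by (induction n) (auto intro: forms_mult)

lemma forms_var_power: "i \<in> B \<Longrightarrow> var i ^ n \<in> forms B n"
  using forms_power[OF forms_var, of i B n] by simp

lemma forms_form_at:
  assumes "\<And>i. a i \<noteq> 0 \<Longrightarrow> p i \<in> forms B d"
  shows "form_at a p \<in> forms B d"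
  unfolding form_at_def
proof (rule forms_sum)
  fix i
  show "cst (a i) * p i \<in> forms B d"
    by (cases "a i = 0") (auto intro: forms_cst_mult assms)
qed

lemma forms_linform: "(\<And>i. a i \<noteq> 0 \<Longrightarrow> i \<in> B) \<Longrightarrow> linform a \<in> forms B 1"
  by (rule forms_form_at) (rule forms_var)

definition order_ge :: "nat \<Rightarrow> ('n::finite, 'k::field) sym \<Rightarrow> bool" where
  "order_ge n f \<longleftrightarrow> (\<forall>t\<in>Poly_Mapping.keys f. n \<le> mon_deg t)"

lemma order_ge_add: "order_ge n f \<Longrightarrow> order_ge n g \<Longrightarrow> order_ge n (f + g)"
  using keys_add[of f g] by (auto simp: order_ge_def)

lemma order_ge_uminus: "order_ge n f \<Longrightarrow> order_ge n (- f)"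
  by (simp add: order_ge_def in_keys_iff)

lemma order_ge_diff: "order_ge n f \<Longrightarrow> order_ge n g \<Longrightarrow> order_ge n (f - g)"
  using order_ge_add[of n f "- g"] order_ge_uminus[of n g] by simp

lemma order_ge_sum: "(\<And>i. i \<in> I \<Longrightarrow> order_ge n (f i)) \<Longrightarrow> order_ge n (sum f I)"
  by (induction I rule: infinite_finite_induct) (auto intro: order_ge_add simp: order_ge_def[of _ 0])

lemma order_ge_forms_mult:
  assumes "f \<in> forms B n"
  shows "order_ge n (f * g)"
  unfolding order_ge_def
proof
  fix u assume "u \<in> Poly_Mapping.keys (f * g)"
  then obtain s t where "s \<in> Poly_Mapping.keys f" "u = s + t"
    using keys_mult[of f g] by blast
  then show "n \<le> mon_deg u"
    using assms by (auto simp: forms_def mon_deg_add)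
qed

lemma lookup_var_power_mult:
  "Poly_Mapping.lookup (var i ^ n * f) t =
     (if n \<le> Poly_Mapping.lookup t i then Poly_Mapping.lookup f (t - Poly_Mapping.single i n) else 0)"
proof (induction f rule: polynomial_induct)
  case (monomial u c)
  have "Poly_Mapping.single i n + u = t \<longleftrightarrow>
      n \<le> Poly_Mapping.lookup t i \<and> u = t - Poly_Mapping.single i n"
    by (auto simp: poly_mapping_eq_iff fun_eq_iff lookup_add lookup_minus lookup_single when_def)
  then show ?case by (auto simp: var_power mult_single lookup_single when_def)
qed (simp_all add: distrib_left lookup_add)

lemma lookup_var_mult:
  "Poly_Mapping.lookup (var i * f) t =
     (if 1 \<le> Poly_Mapping.lookup t i then Poly_Mapping.lookup f (t - Poly_Mapping.single i 1) else 0)"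
  using lookup_var_power_mult[of i 1 f t] by simp

lemma var_power_dvd_iff:
  "var i ^ n dvd f \<longleftrightarrow> (\<forall>t. Poly_Mapping.lookup t i < n \<longrightarrow> Poly_Mapping.lookup f t = 0)"
    (is "_ \<longleftrightarrow> ?V")
proof
  assume "var i ^ n dvd f"
  then show ?V by (auto simp: dvd_def lookup_var_power_mult)
next
  assume V: ?V
  have "var i ^ n dvd Poly_Mapping.single t c" if "n \<le> Poly_Mapping.lookup t i" for t c
  proof
    have "Poly_Mapping.single i n + (t - Poly_Mapping.single i n) = t"
      using that by (auto simp: poly_mapping_eq_iff fun_eq_iff lookup_add lookup_minus lookup_single when_def)
    then show "Poly_Mapping.single t c = var i ^ n * Poly_Mapping.single (t - Poly_Mapping.single i n) c"
      by (simp add: var_power mult_single)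
  qed
  moreover have "n \<le> Poly_Mapping.lookup t i" if "t \<in> Poly_Mapping.keys f" for t
    using V that by (metis in_keys_iff not_le)
  ultimately have "var i ^ n dvd (\<Sum>t\<in>Poly_Mapping.keys f. cst (Poly_Mapping.lookup f t) * Poly_Mapping.single t 1)"
    by (intro dvd_sum dvd_mult) auto
  then show "var i ^ n dvd f" by (simp flip: monomial_expansion)
qed

lemma var_power_cancel:
  assumes "var i ^ n * f = var i ^ n * g"
  shows "f = g"
proof (rule poly_mapping_eqI)
  fix t
  have "Poly_Mapping.lookup (var i ^ n * f) (t + Poly_Mapping.single i n) =
      Poly_Mapping.lookup (var i ^ n * g) (t + Poly_Mapping.single i n)"
    by (simp add: assms)
  then show "Poly_Mapping.lookup f t = Poly_Mapping.lookup g t"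
    by (simp add: lookup_var_power_mult lookup_add)
qed

text \<open>
  Among the monomials of \<open>g\<close> in \<open>Z\<close> take one, \<open>s\<close>, with the largest exponent of \<open>x\<^sub>j\<close>. The coefficient of
  \<open>s x\<^sub>j\<close> in \<open>linform a * g\<close> receives a contribution from \<open>s\<close> only, since the other
  candidates \<open>s x\<^sub>j / x\<^sub>i\<close> lie in \<open>Z\<close> and have a larger exponent of \<open>x\<^sub>j\<close>. With \<open>Z\<close> the set of all monomials
  this shows that a nonzero linear form is not a zero divisor; with \<open>Z\<close> the monomials outside the ideal
  of \<open>x\<^sub>i\<^sup>n\<close> it shows the same modulo that ideal.
\<close>

lemma linform_mult_vanishing:
  assumes j: "a j \<noteq> 0"
    and Z: "\<And>t. t \<in> Z \<Longrightarrow> t + Poly_Mapping.single j 1 \<in> Z"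
      "\<And>t i. t \<in> Z \<Longrightarrow> t + Poly_Mapping.single j 1 - Poly_Mapping.single i 1 \<in> Z"
    and van: "\<And>t. t \<in> Z \<Longrightarrow> Poly_Mapping.lookup (linform a * g) t = 0"
    and t: "t \<in> Z"
  shows "Poly_Mapping.lookup g t = 0"
proof (rule ccontr)
  assume "Poly_Mapping.lookup g t \<noteq> 0"
  then have ne: "Z \<inter> Poly_Mapping.keys g \<noteq> {}" using t by (auto simp: in_keys_iff)
  let ?K = "Z \<inter> Poly_Mapping.keys g"
  have "Max ((\<lambda>t. Poly_Mapping.lookup t j) ` ?K) \<in> (\<lambda>t. Poly_Mapping.lookup t j) ` ?K"
    using ne by (intro Max_in) auto
  then obtain s where s: "s \<in> ?K"
    and s_Max: "Poly_Mapping.lookup s j = Max ((\<lambda>t. Poly_Mapping.lookup t j) ` ?K)"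
    by auto
  have max: "Poly_Mapping.lookup t j \<le> Poly_Mapping.lookup s j" if "t \<in> ?K" for t
    using that by (auto simp: s_Max)
  let ?u = "s + Poly_Mapping.single j 1"
  have "0 = Poly_Mapping.lookup (linform a * g) ?u"
    using s Z van by simp
  also have "\<dots> = (\<Sum>i\<in>UNIV. a i * Poly_Mapping.lookup (var i * g) ?u)"
    by (simp add: form_at_def sum_distrib_right lookup_sum mult.assoc)
  also have "\<dots> = (\<Sum>i\<in>UNIV. if i = j then a j * Poly_Mapping.lookup g s else 0)"
  proof (rule sum.cong)
    fix i
    show "a i * Poly_Mapping.lookup (var i * g) ?u = (if i = j then a j * Poly_Mapping.lookup g s else 0)"
    proof (cases "i = j")
      case False
      let ?v = "?u - Poly_Mapping.single i 1"
      have "Poly_Mapping.lookup ?v j = Suc (Poly_Mapping.lookup s j)"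
        using False by (simp add: lookup_minus lookup_add lookup_single when_def)
      then have "?v \<notin> Poly_Mapping.keys g"
        using max[of ?v] Z(2)[of s i] s by fastforce
      then show ?thesis using False by (simp add: lookup_var_mult in_keys_iff)
    qed (simp add: lookup_var_mult lookup_add)
  qed simp
  also have "\<dots> = a j * Poly_Mapping.lookup g s" by simp
  finally show False using j s by (auto simp: in_keys_iff)
qed

lemma linform_cancel:
  assumes "a j \<noteq> 0" and "linform a * f = linform a * g"
  shows "f = g"
proof -
  have "Poly_Mapping.lookup (f - g) t = 0" for t
    by (rule linform_mult_vanishing[of a j UNIV]) (use assms in \<open>auto simp: right_diff_distrib\<close>)
  then show ?thesis by (intro poly_mapping_eqI) (simp add: lookup_minus)
qed

lemma prod_linform_nonzero:
  assumes "\<And>H. H \<in> I \<Longrightarrow> \<exists>j. a H j \<noteq> 0"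
  shows "(\<Prod>H\<in>I. linform (a H)) \<noteq> (0 :: ('n::finite, 'k::field) sym)"
  using assms
proof (induction I rule: infinite_finite_induct)
  case (insert H I)
  obtain j where "a H j \<noteq> 0" using insert by blast
  with linform_cancel[of "a H" j "\<Prod>H\<in>I. linform (a H)" 0] insert show ?case by auto
qed simp_all

lemma var_power_dvd_linform_mult:
  assumes "a j \<noteq> 0" "j \<noteq> i" and dvd: "var i ^ n dvd linform a * g"
  shows "var i ^ n dvd g"
  unfolding var_power_dvd_iff
proof (intro allI impI)
  fix t assume t: "Poly_Mapping.lookup t i < n"
  show "Poly_Mapping.lookup g t = 0"
    by (rule linform_mult_vanishing[of a j "{t. Poly_Mapping.lookup t i < n}"])
      (use assms t in \<open>auto simp: var_power_dvd_iff lookup_add lookup_minus lookup_single when_def\<close>)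
qed

lemma var_power_dvd_linform_power_mult:
  assumes "a j \<noteq> 0" "j \<noteq> i" and "var i ^ n dvd linform a ^ m * g"
  shows "var i ^ n dvd g"
  using assms(3) by (induction m) (auto simp: mult.assoc dest: var_power_dvd_linform_mult[of a j i n, OF assms(1,2)])

lemma linform_indicator: "linform (\<lambda>i. if i = j then c else 0) = cst c * var j"
proof -
  have "linform (\<lambda>i. if i = j then c else 0) = (\<Sum>i\<in>UNIV. if i = j then cst c * var j else 0)"
    unfolding form_at_def by (rule sum.cong) auto
  then show ?thesis by simp
qed

lemma var_power_dvd_var_power_mult:
  fixes g :: "('n::finite, 'k::field) sym"
  assumes "j \<noteq> i" and "var i ^ n dvd var j ^ m * g"
  shows "var i ^ n dvd g"
  using var_power_dvd_linform_power_mult[of "\<lambda>l. if l = j then 1 else 0" j i n m g] assms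
  by (simp add: linform_indicator)

text \<open>
  The ideal of \<open>x\<^sub>i\<^sup>n\<close> and \<open>x\<^sub>j\<^sup>n\<close> is a monomial ideal, so membership is decided monomial by monomial,
  and multiplication by \<open>x\<^sub>k\<^sup>n\<close> leaves the exponents of \<open>x\<^sub>i\<close> and \<open>x\<^sub>j\<close> unchanged.
\<close>

lemma var_powers_regular:
  fixes f :: "('n::finite, 'k::field) sym"
  assumes ijk: "i \<noteq> k" "j \<noteq> k" and eq: "var k ^ n * f = var i ^ n * p + var j ^ n * q"
  shows "\<exists>p q. f = var i ^ n * p + var j ^ n * q"
proof -
  define I :: "('n, 'k) sym set" where "I = {f. \<exists>p q. f = var i ^ n * p + var j ^ n * q}"
  have add: "f + g \<in> I" if "f \<in> I" "g \<in> I" for f g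
  proof -
    from that obtain p q p' q' where "f = var i ^ n * p + var j ^ n * q" "g = var i ^ n * p' + var j ^ n * q'"
      by (auto simp: I_def)
    then have "f + g = var i ^ n * (p + p') + var j ^ n * (q + q')" by (simp add: algebra_simps)
    then show ?thesis by (auto simp: I_def)
  qed
  have zero: "0 \<in> I" by (auto simp: I_def intro!: exI[of _ 0])
  have sum: "(\<Sum>t\<in>T. h t) \<in> I" if "\<And>t. t \<in> T \<Longrightarrow> h t \<in> I" for T and h :: "_ \<Rightarrow> ('n, 'k) sym"
    using that by (induction T rule: infinite_finite_induct) (auto intro: zero add)
  have mem: "g \<in> I" if "var i ^ n dvd g \<or> var j ^ n dvd g" for g
    using that by (auto simp: dvd_def I_def) (metis add.right_neutral mult_zero_right, metis add.left_neutral mult_zero_right)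
  have "cst (Poly_Mapping.lookup f t) * Poly_Mapping.single t 1 \<in> I" if t: "t \<in> Poly_Mapping.keys f" for t
  proof -
    let ?u = "t + Poly_Mapping.single k n"
    have "Poly_Mapping.lookup (var k ^ n * f) ?u = Poly_Mapping.lookup f t"
      by (simp add: lookup_var_power_mult lookup_add)
    then have "Poly_Mapping.lookup (var i ^ n * p + var j ^ n * q) ?u \<noteq> 0"
      using t eq by (simp add: in_keys_iff)
    then have "n \<le> Poly_Mapping.lookup t i \<or> n \<le> Poly_Mapping.lookup t j"
      using ijk by (auto simp: lookup_add lookup_var_power_mult lookup_single when_def split: if_splits)
    then show ?thesis
      by (intro mem) (auto simp: var_power_dvd_iff cst_mult_single lookup_single when_def)
  qed
  then have "(\<Sum>t\<in>Poly_Mapping.keys f. cst (Poly_Mapping.lookup f t) * Poly_Mapping.single t 1) \<in> I"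
    by (rule sum)
  then have "f \<in> I" by (simp flip: monomial_expansion)
  then show ?thesis by (simp add: I_def)
qed

text \<open>
  Regularity of \<open>z\<close> modulo \<open>x, y\<close> passes from the ring to a free module by comparing coordinates.
  This is the only consequence of freeness used to refute it.
\<close>

lemma free_module_regular:
  fixes s :: "'s::comm_ring_1 \<Rightarrow> 'm::ab_group_add \<Rightarrow> 'm"
  assumes "module s" and free: "free_module s M"
    and mem: "a \<in> M" "b \<in> M" "c \<in> M" and eq: "s z a = s x b + s y c"
    and reg: "\<And>f p q. z * f = x * p + y * q \<Longrightarrow> \<exists>p q. f = x * p + y * q"
  shows "\<exists>b\<in>M. \<exists>c\<in>M. a = s x b + s y c"
proof -
  interpret module s by fact
  obtain E where E: "independent E" "span E = M" using free by (auto simp: free_module_def)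
  let ?r = "representation E"
  have "z * ?r a e = x * ?r b e + y * ?r c e" for e
  proof -
    have "?r (s z a) e = ?r (s x b + s y c) e" by (simp add: eq)
    moreover have "s x b \<in> span E" "s y c \<in> span E" using mem E(2) by (auto intro: span_scale)
    ultimately show ?thesis
      using mem E by (simp add: representation_add representation_scale)
  qed
  then have "\<exists>p q. ?r a e = x * p + y * q" for e
    using reg by blast
  then obtain p q where pq: "\<And>e. ?r a e = x * p e + y * q e" by metis
  let ?F = "{e. ?r a e \<noteq> 0}"
  have "a = (\<Sum>e\<in>?F. s (?r a e) e)"
    using E mem by (simp add: sum_nonzero_representation_eq)
  also have "\<dots> = (\<Sum>e\<in>?F. s x (s (p e) e) + s y (s (q e) e))"
    by (simp add: pq scale_left_distrib)
  also have "\<dots> = s x (\<Sum>e\<in>?F. s (p e) e) + s y (\<Sum>e\<in>?F. s (q e) e)"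
    by (simp add: sum.distrib scale_sum_right)
  finally have "a = s x (\<Sum>e\<in>?F. s (p e) e) + s y (\<Sum>e\<in>?F. s (q e) e)" .
  moreover have "(\<Sum>e\<in>?F. s (h e) e) \<in> span E" for h
    using representation_ne_zero[of E a] by (intro span_sum span_scale span_base) auto
  ultimately show ?thesis unfolding E(2) by blast
qed

section \<open>A long circuit obstructs freeness\<close>

lemma cst_mult_power_dvd_iff:
  assumes "c \<noteq> 0"
  shows "(cst c * x) ^ n dvd cst c * y \<longleftrightarrow> x ^ n dvd y"
proof
  have inv: "cst (inverse c) * (cst c * z) = z" "cst c * (cst (inverse c) * z) = z" for z
    using assms by (simp_all flip: mult.assoc cst_mult)
  have pow: "(cst d * x) ^ n = cst (d ^ n) * x ^ n" for d
    by (simp add: power_mult_distrib cst_power)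
  show "x ^ n dvd y" if "(cst c * x) ^ n dvd cst c * y"
  proof -
    have "x ^ n dvd (cst c * x) ^ n" by (simp add: pow)
    also note that
    also have "cst c * y dvd cst (inverse c) * (cst c * y)" by simp
    finally show ?thesis by (simp add: inv)
  qed
  show "(cst c * x) ^ n dvd cst c * y" if "x ^ n dvd y"
  proof -
    have "cst (c ^ n) * x ^ n dvd cst (inverse c ^ n) * (cst (c ^ n) * x ^ n)" by simp
    also have "\<dots> = x ^ n" using assms by (simp flip: mult.assoc cst_mult power_mult_distrib)
    also note that
    also have "y dvd cst c * y" by simp
    finally show ?thesis by (simp add: pow)
  qed
qed

lemma form_at_indicator: "form_at (\<lambda>i. if i = j then c else 0) p = cst c * p j"
proof -
  have "form_at (\<lambda>i. if i = j then c else 0) p = (\<Sum>i\<in>UNIV. if i = j then cst c * p j else 0)"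
    unfolding form_at_def by (rule sum.cong) auto
  then show ?thesis by simp
qed

lemma form_at_indicator_set: "form_at (\<lambda>i. if i \<in> J then 1 else 0) p = (\<Sum>j\<in>J. p j)"
proof -
  have "form_at (\<lambda>i. if i \<in> J then 1 else 0) p = (\<Sum>i\<in>UNIV. if i \<in> J then p i else 0)"
    unfolding form_at_def by (rule sum.cong) auto
  then show ?thesis by (simp add: sum.If_cases)
qed

text \<open>
  The long circuit is \<open>B\<close> together with \<open>H0\<close>. The matrix \<open>a\<close> is written in coordinates where the members
  of \<open>B\<close> are coordinate hyperplanes and \<open>H0\<close> is the vanishing of the sum of these coordinates.
  Any three members of \<open>B\<close> provide the Koszul relation that contradicts freeness.
\<close>

theorem long_circuit_not_free:
  fixes a :: "'h \<Rightarrow> 'n::finite \<Rightarrow> 'k::field"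
  assumes fin: "finite A" and B: "B \<subseteq> A" "3 \<le> card B" and H0: "H0 \<in> A" "H0 \<notin> B"
    and inj: "inj_on \<iota> B"
    and aB: "\<And>H. H \<in> B \<Longrightarrow> a H = (\<lambda>i. if i = \<iota> H then c H else 0)"
    and c: "\<And>H. H \<in> B \<Longrightarrow> c H \<noteq> 0"
    and aH0: "a H0 = (\<lambda>i. if i \<in> \<iota> ` B then 1 else 0)"
    and nz: "\<And>H. H \<in> A \<Longrightarrow> \<exists>j. a H j \<noteq> 0"
  shows "\<exists>m. (\<forall>H\<in>A. m H > 0) \<and> \<not> free_module vscale (log_vectors a A m)"
proof -
  define R where "R = A - insert H0 B"
  \<comment> \<open>One more than the degree of the product \<open>Q\<close> of the forms outside the circuit.\<close>
  define N where "N = Suc (card R)"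
  define m where "m H = (if H \<in> insert H0 B then N else 1)" for H
  define Q :: "('n, 'k) sym" where "Q = (\<Prod>H\<in>R. linform (a H))"
  let ?M = "log_vectors a A m"
  let ?J = "\<iota> ` B"
  let ?x = "\<lambda>i. var i ^ N :: ('n, 'k) sym"
  have M_iff: "p \<in> ?M \<longleftrightarrow> (\<forall>H\<in>R. linform (a H) dvd form_at (a H) p) \<and> (\<forall>j\<in>?J. ?x j dvd p j) \<and>
      linform (a H0) ^ N dvd (\<Sum>j\<in>?J. p j)" for p
  proof -
    have "A = R \<union> B \<union> {H0}" using B(1) H0(1) by (auto simp: R_def)
    moreover have "linform (a H) ^ m H dvd form_at (a H) p \<longleftrightarrow> ?x (\<iota> H) dvd p (\<iota> H)" if "H \<in> B" for H
      using that by (simp add: aB form_at_indicator m_def cst_mult_power_dvd_iff[OF c])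
    moreover have "form_at (a H0) p = (\<Sum>j\<in>?J. p j)"
      unfolding aH0 by (rule form_at_indicator_set)
    moreover have "linform (a H) ^ m H dvd form_at (a H) p \<longleftrightarrow> linform (a H) dvd form_at (a H) p"
      if "H \<in> R" for H using that by (simp add: m_def R_def)
    moreover have "m H0 = N" by (simp add: m_def)
    ultimately show ?thesis by (auto simp: log_vectors_def)
  qed
  have "3 \<le> card ?J" using B(2) inj by (simp add: card_image)
  then obtain J' where J': "J' \<subseteq> ?J" "card J' = 3" by (rule obtain_subset_with_card_n)
  then obtain i j k where "J' = {i, j, k}" "i \<noteq> j" "i \<noteq> k" "j \<noteq> k"
    by (metis card_3_iff)
  with J'(1) have ijk: "i \<in> ?J" "j \<in> ?J" "k \<in> ?J" "i \<noteq> j" "i \<noteq> k" "j \<noteq> k"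
    by blast+
  \<comment> \<open>The factor \<open>Q\<close> takes care of the hyperplanes outside the circuit, the powers of \<open>x\<^sub>u\<close> and \<open>x\<^sub>v\<close>
    of two members of \<open>B\<close>, and at \<open>H0\<close> the two entries cancel.\<close>
  define e where "e u v = (\<lambda>l. Q * ?x u * ?x v * (if l = u then 1 else if l = v then - 1 else 0))" for u v
  have e_M: "e u v \<in> ?M" if uv: "u \<in> ?J" "v \<in> ?J" "u \<noteq> v" for u v
  proof -
    have "(\<Sum>l\<in>?J. e u v l) = Q * ?x u * ?x v * (\<Sum>l\<in>?J. (if l = u then 1 else 0) + (if l = v then - 1 else 0))"
      unfolding e_def sum_distrib_left by (rule sum.cong) (use uv in auto)
    also have "(\<Sum>l\<in>?J. (if l = u then 1 else 0) + (if l = v then - 1 else 0)) = (0 :: ('n, 'k) sym)"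
      using uv finite_subset[OF B(1) fin] by (simp add: sum.distrib)
    finally have "(\<Sum>l\<in>?J. e u v l) = 0" by simp
    moreover have "?x l dvd e u v l" for l
      by (cases "l = u"; cases "l = v") (simp_all add: e_def mult.assoc)
    moreover have "linform (a H) dvd form_at (a H) (e u v)" if "H \<in> R" for H
    proof -
      have "linform (a H) dvd Q"
        unfolding Q_def using that fin by (intro dvd_prodI) (auto simp: R_def)
      also have "Q dvd form_at (a H) (e u v)"
        unfolding form_at_def by (intro dvd_sum) (simp add: e_def mult.assoc)
      finally show ?thesis .
    qed
    ultimately show ?thesis by (simp add: M_iff)
  qed
  have cocycle: "vscale (?x k) (e i j) = vscale (?x i) (e k j) + vscale (?x j) (e i k)"
    using ijk by (auto simp: vscale_def e_def fun_eq_iff)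
  have "\<not> free_module vscale ?M"
  proof
    assume "free_module vscale ?M"
    then obtain r s where rs: "r \<in> ?M" "s \<in> ?M" and e_rs: "e i j = vscale (?x i) r + vscale (?x j) s"
      using free_module_regular[OF module_vscale _ e_M e_M e_M cocycle] var_powers_regular[of i k j N] ijk
      by blast
    \<comment> \<open>Comparing the entries of \<open>e i j\<close> gives the residue of every entry of \<open>s\<close> modulo \<open>x\<^sub>i\<^sup>N\<close>:
      \<open>s i\<close> is \<open>x\<^sub>i\<^sup>N\<close> times something congruent to \<open>Q\<close>, the others are multiples of \<open>x\<^sub>i\<^sup>N x\<^sub>l\<^sup>N\<close>.\<close>
    have val: "e i j l = ?x i * r l + ?x j * s l" for l
      by (simp add: e_rs vscale_def)
    have "?x i dvd r i" "?x i dvd s i" using rs ijk by (auto simp: M_iff)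
    then obtain g f where g: "r i = ?x i * g" and f: "s i = ?x i * f" by (auto simp: dvd_def)
    have "?x i * (Q * ?x j) = ?x i * (?x i * g + ?x j * f)"
      using val[of i] by (simp add: e_def g f algebra_simps)
    then have "Q * ?x j = ?x i * g + ?x j * f" by (rule var_power_cancel)
    then have "?x i dvd ?x j * (Q - f)" by (simp add: algebra_simps)
    then have Qf: "?x i dvd Q - f"
      by (rule var_power_dvd_var_power_mult[rotated]) (use ijk in simp)
    have "\<exists>h. s l = ?x i * (?x l * h)" if l: "l \<in> ?J" "l \<noteq> i" for l
    proof -
      have "?x i dvd e i j l" using l by (simp add: e_def mult.assoc)
      then have "?x i dvd ?x j * s l" unfolding val by (simp add: dvd_add_right_iff)
      then have "?x i dvd s l"
        by (rule var_power_dvd_var_power_mult[rotated]) (use ijk in simp)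
      moreover obtain h where h: "s l = ?x l * h" using rs l by (auto simp: M_iff dvd_def)
      ultimately have "?x i dvd ?x l * h" by simp
      then have "?x i dvd h" by (rule var_power_dvd_var_power_mult[rotated]) (use l in simp)
      then obtain h' where "h = ?x i * h'" by (auto simp: dvd_def)
      then have "s l = ?x i * (?x l * h')" by (simp add: h mult.left_commute)
      then show ?thesis by blast
    qed
    then obtain h where h: "\<And>l. l \<in> ?J - {i} \<Longrightarrow> s l = ?x i * (?x l * h l)" by (metis DiffE singletonI)
    let ?S = "\<Sum>l\<in>?J - {i}. ?x l * h l"
    have sum: "(\<Sum>l\<in>?J. s l) = ?x i * (f + ?S)"
      using ijk finite_subset[OF B(1) fin]
      by (simp add: sum.remove[of ?J i] f h sum_distrib_left distrib_left)
    \<comment> \<open>The condition at \<open>H0\<close> bounds the sum of these entries; dividing it by \<open>x\<^sub>i\<^sup>N\<close> expresses \<open>Q\<close> by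
      \<open>N\<close>-th powers of the forms of the circuit.\<close>
    obtain w where w: "(\<Sum>l\<in>?J. s l) = linform (a H0) ^ N * w" using rs by (auto simp: M_iff dvd_def)
    have "?x i dvd w"
    proof (rule var_power_dvd_linform_power_mult)
      show "a H0 j \<noteq> 0" "j \<noteq> i" using ijk by (simp_all add: aH0)
      show "?x i dvd linform (a H0) ^ N * w" by (simp flip: w add: sum)
    qed
    then obtain w' where w': "w = ?x i * w'" by (auto simp: dvd_def)
    have "?x i * (f + ?S) = ?x i * (linform (a H0) ^ N * w')"
      using w sum by (simp add: w' mult.left_commute)
    then have "f + ?S = linform (a H0) ^ N * w'" by (rule var_power_cancel)
    moreover obtain q where "Q - f = ?x i * q" using Qf by (auto simp: dvd_def)
    ultimately have Q_eq: "Q = ?x i * q + linform (a H0) ^ N * w' - ?S"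
      by (simp add: algebra_simps)
    have pow: "f \<in> forms UNIV 1 \<Longrightarrow> order_ge N (f ^ N * g)" for f g :: "('n, 'k) sym"
      using order_ge_forms_mult[OF forms_power, of f UNIV 1 N g] by simp
    have "order_ge N Q"
      unfolding Q_eq
      by (intro order_ge_diff order_ge_add order_ge_sum pow forms_var forms_linform) auto
    moreover have "Q \<in> forms UNIV (card R)"
    proof -
      have "(\<Prod>H\<in>I. linform (a H)) \<in> forms UNIV (card I)" if "finite I" for I
        using that
      proof (induction I)
        case (insert H I)
        then show ?case using forms_mult[OF forms_linform, of "a H" UNIV] by simp
      qed simp
      then show ?thesis using fin by (simp add: Q_def R_def)
    qed
    moreover have "Q \<noteq> 0"
      unfolding Q_def using nz by (intro prod_linform_nonzero) (auto simp: R_def)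
    ultimately show False
      by (fastforce simp: order_ge_def forms_def N_def poly_mapping_eq_iff fun_eq_iff in_keys_iff)
  qed
  moreover have "\<forall>H\<in>A. m H > 0" by (simp add: m_def N_def)
  ultimately show ?thesis by blast
qed

section \<open>Blocks of rank at most two are totally free\<close>

definition lincomb :: "('n::finite \<Rightarrow> 's::comm_ring_1) \<Rightarrow> ('n \<Rightarrow> 'n \<Rightarrow> 's) \<Rightarrow> 'n \<Rightarrow> 's" where
  "lincomb f P = (\<lambda>i. \<Sum>k\<in>UNIV. f k * P k i)"

text \<open>
  A basis of a free logarithmic module has as many elements as there are variables. Indexing it by the
  variables lets each basis element be assigned to the block of its index.
\<close>

definition vbasis :: "('n::finite \<Rightarrow> 'n \<Rightarrow> 's::comm_ring_1) \<Rightarrow> ('n \<Rightarrow> 's) set \<Rightarrow> bool" where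
  "vbasis P M \<longleftrightarrow> M = range (\<lambda>f. lincomb f P) \<and> (\<forall>f. lincomb f P = 0 \<longrightarrow> f = 0)"

lemma lincomb_indicator: "lincomb (\<lambda>j. if j = k then c else 0) P = (\<lambda>i. c * P k i)"
proof
  fix i
  have "lincomb (\<lambda>j. if j = k then c else 0) P i = (\<Sum>j\<in>UNIV. if j = k then c * P k i else 0)"
    unfolding lincomb_def by (rule sum.cong) auto
  then show "lincomb (\<lambda>j. if j = k then c else 0) P i = c * P k i" by simp
qed

lemma vbasis_mem:
  assumes "vbasis P M"
  shows "P k \<in> M"
proof -
  have "lincomb (\<lambda>j. if j = k then 1 else 0) P \<in> range (\<lambda>f. lincomb f P)" by (rule rangeI)
  then show ?thesis using assms by (simp add: vbasis_def lincomb_indicator)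
qed

lemma sum_vscale_apply: "(\<Sum>k\<in>K. vscale (f k) (p k)) i = (\<Sum>k\<in>K. f k * p k i)"
  by (induction K rule: infinite_finite_induct) (simp_all add: vscale_def)

lemma vbasis_free:
  fixes P :: "'n::finite \<Rightarrow> 'n \<Rightarrow> 's::comm_ring_1"
  assumes "vbasis P M"
  shows "free_module vscale M"
proof -
  interpret module "vscale :: 's \<Rightarrow> ('n \<Rightarrow> 's) \<Rightarrow> _" by (rule module_vscale)
  have M: "M = range (\<lambda>f. lincomb f P)" and ind: "\<And>f. lincomb f P = 0 \<Longrightarrow> f = 0"
    using assms by (auto simp: vbasis_def)
  have inj: "inj P"
  proof (rule injI, rule ccontr)
    fix k l assume kl: "P k = P l" "k \<noteq> l"
    let ?f = "\<lambda>j. (if j = k then 1 else 0) - (if j = l then 1 else 0) :: 's"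
    have "lincomb ?f P = (\<lambda>i. lincomb (\<lambda>j. if j = k then 1 else 0) P i - lincomb (\<lambda>j. if j = l then 1 else 0) P i)"
      by (simp add: lincomb_def left_diff_distrib sum_subtractf)
    also have "\<dots> = 0" using kl by (simp add: lincomb_indicator fun_eq_iff)
    finally have "?f = 0" by (rule ind)
    then have "?f k = (0 :: 'n \<Rightarrow> 's) k" by (rule fun_cong)
    then show False using kl(2) by simp
  qed
  have sum: "(\<Sum>v\<in>range P. vscale (u v) v) = lincomb (\<lambda>k. u (P k)) P" for u
    by (rule ext) (simp add: sum.reindex[OF inj] sum_vscale_apply lincomb_def)
  have "independent (range P)"
    by (auto simp: dependent_finite sum dest!: ind) (auto simp: fun_eq_iff)
  moreover have "span (range P) = M"
  proof -
    have "lincomb f P \<in> range (\<lambda>u. lincomb (\<lambda>k. u (P k)) P)" for f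
      using inj by (intro image_eqI[of _ _ "\<lambda>v. f (inv P v)"]) auto
    then show ?thesis by (auto simp: span_finite sum M)
  qed
  ultimately show ?thesis by (auto simp: free_module_def)
qed

text \<open>
  The vectors \<open>lincomb f P\<close> with \<open>\<Sum>\<^sub>k f\<^sub>k q\<^sub>k\<close> divisible by \<open>l\<close> form the kernel of a map onto an ideal of
  the ring modulo \<open>l\<close>. As all residues \<open>q\<^sub>k\<close> are multiples of the nonzero divisor \<open>q\<^sub>k\<^sub>0\<close>, subtracting these
  multiples of \<open>P k0\<close> moves the other basis vectors into the kernel, and of \<open>P k0\<close> itself exactly the
  multiples by \<open>l\<close> remain.
\<close>

lemma vbasis_step:
  fixes P :: "'n::finite \<Rightarrow> 'n \<Rightarrow> 's::comm_ring_1"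
  assumes P: "vbasis P M"
    and cancel: "\<And>f. l * f = 0 \<Longrightarrow> f = 0"
    and q: "\<And>k. k \<noteq> k0 \<Longrightarrow> l dvd q k - \<epsilon> k * q k0"
    and reg: "\<And>f. l dvd q k0 * f \<Longrightarrow> l dvd f"
  shows "vbasis (\<lambda>k i. if k = k0 then l * P k0 i else P k i - \<epsilon> k * P k0 i)
    {lincomb f P | f. l dvd (\<Sum>k\<in>UNIV. f k * q k)}"
    (is "vbasis ?P ?M")
proof -
  let ?K = "UNIV - {k0}"
  \<comment> \<open>The coordinates with respect to \<open>P\<close> of the vector with coordinates \<open>f\<close> in the new family.\<close>
  define tr where "tr f = (\<lambda>k. if k = k0 then l * f k0 - (\<Sum>k\<in>?K. f k * \<epsilon> k) else f k)" for f
  have split: "sum g UNIV = g k0 + sum g ?K" for g :: "'n \<Rightarrow> 's"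
    by (simp add: sum.remove[of UNIV k0])
  have comb: "lincomb f ?P = lincomb (tr f) P" for f
  proof
    fix i
    have "(\<Sum>k\<in>?K. f k * (if k = k0 then l * P k0 i else P k i - \<epsilon> k * P k0 i)) =
        (\<Sum>k\<in>?K. f k * P k i - f k * \<epsilon> k * P k0 i)"
      by (rule sum.cong) (auto simp: algebra_simps)
    moreover have "(\<Sum>k\<in>?K. tr f k * P k i) = (\<Sum>k\<in>?K. f k * P k i)"
      by (rule sum.cong) (auto simp: tr_def)
    ultimately show "lincomb f ?P i = lincomb (tr f) P i"
      by (simp add: lincomb_def split sum_subtractf)
        (simp add: tr_def algebra_simps sum_distrib_left sum_distrib_right)
  qed
  have q_sum: "(\<Sum>k\<in>UNIV. f k * q k) =
      (f k0 + (\<Sum>k\<in>?K. f k * \<epsilon> k)) * q k0 + (\<Sum>k\<in>?K. f k * (q k - \<epsilon> k * q k0))" for f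
    by (simp add: split algebra_simps sum_subtractf sum_distrib_left sum_distrib_right)
  have rest: "l dvd (\<Sum>k\<in>?K. f k * (q k - \<epsilon> k * q k0))" for f
    using q by (intro dvd_sum dvd_mult) auto
  have "\<exists>g. tr g = f" if "l dvd (\<Sum>k\<in>UNIV. f k * q k)" for f
  proof -
    have "l dvd q k0 * (f k0 + (\<Sum>k\<in>?K. f k * \<epsilon> k))"
      using that rest[of f] by (simp add: q_sum dvd_add_left_iff mult.commute)
    then obtain h where h: "f k0 + (\<Sum>k\<in>?K. f k * \<epsilon> k) = l * h"
      using reg by (auto simp: dvd_def)
    have "(\<Sum>k\<in>?K. (f(k0 := h)) k * \<epsilon> k) = (\<Sum>k\<in>?K. f k * \<epsilon> k)"
      by (rule sum.cong) auto
    then have "tr (f(k0 := h)) = f"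
      by (auto simp: tr_def fun_eq_iff simp flip: h)
    then show ?thesis by blast
  qed
  moreover have "l dvd (\<Sum>k\<in>UNIV. tr f k * q k)" for f
  proof -
    have "(\<Sum>k\<in>?K. tr f k * \<epsilon> k) = (\<Sum>k\<in>?K. f k * \<epsilon> k)"
      by (rule sum.cong) (auto simp: tr_def)
    then have "tr f k0 + (\<Sum>k\<in>?K. tr f k * \<epsilon> k) = l * f k0" by (simp add: tr_def)
    then show ?thesis using rest[of "tr f"] by (simp add: q_sum mult.assoc)
  qed
  ultimately have "?M = range (\<lambda>f. lincomb f ?P)"
    unfolding comb by (auto simp: image_iff)
  moreover have "f = 0" if "lincomb f ?P = 0" for f
  proof -
    have "tr f = 0" using that P by (simp add: comb vbasis_def)
    then have tr: "tr f k = 0" for k by simp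
    then have off: "f k = 0" if "k \<noteq> k0" for k using that by (metis tr_def)
    then have "(\<Sum>k\<in>?K. f k * \<epsilon> k) = 0" by (intro sum.neutral) auto
    then have "l * f k0 = 0" using tr[of k0] by (simp add: tr_def)
    then have "f k0 = 0" by (rule cancel)
    with off have "f k = 0" for k by (cases "k = k0") auto
    then show ?thesis by (simp add: fun_eq_iff)
  qed
  ultimately show ?thesis by (auto simp: vbasis_def)
qed

text \<open>
  Division of a form \<open>q\<close> of degree \<open>d\<close> by the linear form \<open>l\<close> with remainder a scalar multiple of
  \<open>\<beta>\<^sup>d\<close>. The quotient has degree \<open>d - 1\<close>; for \<open>d = 0\<close> this subtraction is truncated, and the quotient has
  to be zero.
\<close>

definition remainder :: "'n set \<Rightarrow> ('n::finite, 'k::field) sym \<Rightarrow> ('n, 'k) sym \<Rightarrow> nat \<Rightarrow> ('n, 'k) sym \<Rightarrow> bool" where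
  "remainder B l \<beta> d q \<longleftrightarrow>
     (\<exists>c. \<exists>r\<in>forms B (d - 1). (d = 0 \<longrightarrow> r = 0) \<and> q = cst c * \<beta> ^ d + l * r)"

lemma remainder_0: "remainder B l \<beta> d 0"
  by (auto simp: remainder_def intro!: exI[of _ 0] bexI[of _ 0])

lemma remainder_add:
  assumes "remainder B l \<beta> d p" "remainder B l \<beta> d q"
  shows "remainder B l \<beta> d (p + q)"
proof -
  from assms obtain c r c' r' where *: "r \<in> forms B (d - 1)" "d = 0 \<longrightarrow> r = 0" "p = cst c * \<beta> ^ d + l * r"
    "r' \<in> forms B (d - 1)" "d = 0 \<longrightarrow> r' = 0" "q = cst c' * \<beta> ^ d + l * r'"
    by (auto simp: remainder_def)
  then have "p + q = cst (c + c') * \<beta> ^ d + l * (r + r')" by (simp add: cst_add algebra_simps)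
  with * show ?thesis unfolding remainder_def by (meson add_0 forms_add)
qed

lemma remainder_cst_mult:
  assumes "remainder B l \<beta> d q"
  shows "remainder B l \<beta> d (cst c * q)"
proof -
  from assms obtain c' r where *: "r \<in> forms B (d - 1)" "d = 0 \<longrightarrow> r = 0" "q = cst c' * \<beta> ^ d + l * r"
    by (auto simp: remainder_def)
  then have "cst c * q = cst (c * c') * \<beta> ^ d + l * (cst c * r)" by (simp add: cst_mult algebra_simps)
  with * show ?thesis unfolding remainder_def by (meson mult_zero_right forms_cst_mult)
qed

lemma remainder_of_monomials:
  assumes "\<And>t. Poly_Mapping.keys t \<subseteq> B \<Longrightarrow> mon_deg t = d \<Longrightarrow> remainder B l \<beta> d (Poly_Mapping.single t 1)"
    and "q \<in> forms B d"
  shows "remainder B l \<beta> d q"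
proof -
  have sum: "remainder B l \<beta> d (sum h T)" if "\<And>t. t \<in> T \<Longrightarrow> remainder B l \<beta> d (h t)"
    for T :: "('a \<Rightarrow>\<^sub>0 nat) set" and h
    using that by (induction T rule: infinite_finite_induct) (auto intro: remainder_0 remainder_add)
  have "remainder B l \<beta> d (cst (Poly_Mapping.lookup q t) * Poly_Mapping.single t 1)"
    if "t \<in> Poly_Mapping.keys q" for t
    using assms(2) that by (intro remainder_cst_mult assms(1)) (auto simp: forms_def)
  then have "remainder B l \<beta> d
      (\<Sum>t\<in>Poly_Mapping.keys q. cst (Poly_Mapping.lookup q t) * Poly_Mapping.single t 1)"
    by (rule sum)
  then show ?thesis by (simp flip: monomial_expansion)
qed

text \<open>
  Modulo \<open>l\<close> the variable \<open>x\<^sub>j\<close> is a multiple of \<open>x\<^sub>k\<close>, so all binary monomials of the same degree become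
  proportional.
\<close>

lemma remainder_pair_power:
  assumes B: "B = {j, k}" and l: "l = cst x * var j + cst y * var k" and x: "x \<noteq> 0"
  shows "remainder B l (var k) (s + u) (var j ^ s * var k ^ u)"
proof (induction s arbitrary: u)
  case 0
  show ?case by (auto simp: remainder_def intro!: exI[of _ 1] bexI[of _ 0])
next
  case (Suc s)
  let ?w = "var j ^ s * var k ^ u"
  have w: "?w \<in> forms B (s + u)"
    by (intro forms_mult forms_var_power) (auto simp: B)
  from Suc.IH[of "Suc u"] obtain c r where r: "r \<in> forms B (s + u)"
      "var j ^ s * var k ^ Suc u = cst c * var k ^ (Suc s + u) + l * r"
    by (auto simp: remainder_def)
  have inv: "cst (1 / x) * cst x = 1" using x by (simp flip: cst_mult)
  have "var j ^ Suc s * var k ^ u = (cst (1 / x) * cst x) * var j * ?w"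
    by (simp add: inv mult.assoc)
  also have "\<dots> = cst (1 / x) * (l * ?w) - cst (y / x) * (var j ^ s * var k ^ Suc u)"
  proof -
    have xy: "cst (1 / x) * cst y = cst (y / x)" by (simp flip: cst_mult)
    have "cst (1 / x) * (l * ?w) =
        (cst (1 / x) * cst x) * var j * ?w + (cst (1 / x) * cst y) * (var j ^ s * var k ^ Suc u)"
      by (simp add: l algebra_simps)
    then show ?thesis by (simp only: xy) simp
  qed
  also have "\<dots> = cst (- (y / x) * c) * var k ^ (Suc s + u) + l * (cst (1 / x) * ?w + cst (- (y / x)) * r)"
    by (simp only: r(2) cst_mult cst_uminus) (simp add: algebra_simps)
  finally have "var j ^ Suc s * var k ^ u = \<dots>" .
  moreover have "cst (1 / x) * ?w + cst (- (y / x)) * r \<in> forms B (s + u)"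
    by (intro forms_add forms_cst_mult w r)
  ultimately show ?case unfolding remainder_def by (intro exI bexI conjI) auto
qed

text \<open>
  If two variables are involved, \<open>\<beta>\<close> is one of them, namely the one other than some \<open>x\<^sub>j\<close> occurring in
  the linear form. If \<open>x\<^sub>j\<close> is the only variable, forms of positive degree are divisible by the linear
  form and leave remainder zero; then \<open>\<beta> = 1\<close> serves the purpose, although it is not a linear form.
\<close>

lemma remainder_exists:
  fixes a :: "'n::finite \<Rightarrow> 'k::field"
  assumes B: "card B \<le> 2" and supp: "\<And>i. a i \<noteq> 0 \<Longrightarrow> i \<in> B" and j: "a j \<noteq> 0"
  obtains \<beta> where "\<And>f. linform a dvd \<beta> * f \<Longrightarrow> linform a dvd f"
    and "B = {j} \<or> \<beta> \<in> forms B 1"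
    and "\<And>d q. q \<in> forms B d \<Longrightarrow> remainder B (linform a) \<beta> d q"
proof (cases "B = {j}")
  case True
  have l: "linform a = cst (a j) * var j"
  proof -
    have "a = (\<lambda>i. if i = j then a j else 0)" using supp True by (auto simp: fun_eq_iff)
    then show ?thesis by (metis linform_indicator)
  qed
  have mono: "remainder B (linform a) 1 d (Poly_Mapping.single t 1)"
    if "Poly_Mapping.keys t \<subseteq> B" "mon_deg t = d" for t d
  proof -
    have "Poly_Mapping.single t 1 = (var j ^ Poly_Mapping.lookup t j :: ('n, 'k) sym)"
    proof -
      have "t = Poly_Mapping.single j (Poly_Mapping.lookup t j)"
        using that(1) True by (intro poly_mapping_eqI) (auto simp: lookup_single when_def in_keys_iff)
      then show ?thesis by (metis var_power)
    qed
    moreover have "Poly_Mapping.lookup t j = d"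
    proof -
      have "mon_deg t = (\<Sum>i\<in>UNIV. if i = j then Poly_Mapping.lookup t j else 0)"
        unfolding mon_deg_def by (rule sum.cong) (use that(1) True in \<open>auto simp: in_keys_iff\<close>)
      then show ?thesis using that(2) by simp
    qed
    ultimately have t: "Poly_Mapping.single t 1 = (var j ^ d :: ('n, 'k) sym)" by simp
    show ?thesis
    proof (cases d)
      case 0
      then show ?thesis by (auto simp: remainder_def t intro!: exI[of _ 1] bexI[of _ 0])
    next
      case (Suc e)
      have "var j ^ e \<in> forms B e" using True by (intro forms_var_power) simp
      moreover have "var j ^ d = linform a * (cst (1 / a j) * var j ^ e)"
      proof -
        have "cst (a j) * cst (1 / a j) = (1 :: ('n, 'k) sym)" using j by (simp flip: cst_mult)
        then show ?thesis by (simp add: l Suc algebra_simps)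
      qed
      ultimately show ?thesis
        by (auto simp: remainder_def t Suc intro!: exI[of _ 0] bexI forms_cst_mult)
    qed
  qed
  show ?thesis
    by (rule that[of 1]) (use True remainder_of_monomials[OF mono] in auto)
next
  case False
  have "card B \<noteq> 1" using False supp[OF j] by (auto simp: card_1_singleton_iff)
  then have "card B = 2" using B supp[OF j] by (cases "card B") auto
  then obtain k where k: "B = {j, k}" "j \<noteq> k" using supp[OF j] by (auto simp: card_2_iff)
  have l: "linform a = cst (a j) * var j + cst (a k) * var k"
  proof -
    have "linform a = (\<Sum>i\<in>{j, k}. cst (a i) * var i)"
    proof -
      have "a i = 0" if "i \<notin> {j, k}" for i using supp[of i] that k by auto
      then show ?thesis unfolding form_at_def by (intro sum.mono_neutral_right) auto
    qed
    then show ?thesis using k by simp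
  qed
  have mono: "remainder B (linform a) (var k) d (Poly_Mapping.single t 1)"
    if t: "Poly_Mapping.keys t \<subseteq> B" "mon_deg t = d" for t d
  proof -
    have sum: "sum h UNIV = h j + h k" if "\<And>i. i \<notin> B \<Longrightarrow> h i = 0" for h :: "'n \<Rightarrow> nat"
    proof -
      have "sum h UNIV = sum h {j, k}" using that k by (intro sum.mono_neutral_right) auto
      then show ?thesis using k by simp
    qed
    have "mon_deg t = Poly_Mapping.lookup t j + Poly_Mapping.lookup t k"
      unfolding mon_deg_def using t(1) by (intro sum) (auto simp: in_keys_iff)
    moreover have "Poly_Mapping.single t 1 =
        (var j ^ Poly_Mapping.lookup t j * var k ^ Poly_Mapping.lookup t k :: ('n, 'k) sym)"
    proof -
      have "t = Poly_Mapping.single j (Poly_Mapping.lookup t j) + Poly_Mapping.single k (Poly_Mapping.lookup t k)"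
        using t(1) k by (intro poly_mapping_eqI) (auto simp: lookup_add lookup_single when_def in_keys_iff)
      then show ?thesis by (simp add: var_power mult_single)
    qed
    ultimately show ?thesis
      using remainder_pair_power[OF k(1) l j, of "Poly_Mapping.lookup t j" "Poly_Mapping.lookup t k"] t(2)
      by simp
  qed
  show ?thesis
  proof (rule that[of "var k"])
    fix f assume "linform a dvd var k * f"
    then obtain g where g: "var k * f = linform a * g" by (auto simp: dvd_def)
    then have "var k ^ 1 dvd linform a * g" by (metis dvd_triv_left power_one_right)
    then have "var k ^ 1 dvd g" by (rule var_power_dvd_linform_mult[of a j, OF j k(2)])
    then obtain g' where "g = var k ^ 1 * g'" by (auto simp: dvd_def)
    then have "var k ^ 1 * f = var k ^ 1 * (linform a * g')" using g by (simp add: mult.left_commute)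
    then have "f = linform a * g'" by (rule var_power_cancel)
    then show "linform a dvd f" by simp
  qed (use k remainder_of_monomials[OF mono] in \<open>auto intro: forms_var[unfolded One_nat_def]\<close>)
qed

lemma linear_form_not_dvd_1:
  assumes "l \<in> forms B 1"
  shows "\<not> l dvd (1 :: ('n::finite, 'k::field) sym)"
proof
  assume "l dvd (1 :: ('n, 'k) sym)"
  then obtain g where g: "1 = l * g" by (auto simp: dvd_def)
  have "order_ge 1 (l * g)" using assms by (rule order_ge_forms_mult)
  then have "order_ge 1 (1 :: ('n, 'k) sym)" by (simp only: g[symmetric])
  then show False by (simp add: order_ge_def)
qed

lemma dvd_cst_power_mult:
  assumes reg: "\<And>f. l dvd \<beta> * f \<Longrightarrow> l dvd f" and c: "c \<noteq> 0" and dvd: "l dvd cst c * \<beta> ^ e * f"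
  shows "l dvd f"
proof -
  have "l dvd cst (1 / c) * (cst c * \<beta> ^ e * f)" using dvd by (rule dvd_mult)
  also have "\<dots> = \<beta> ^ e * f" using c by (simp flip: mult.assoc cst_mult)
  finally show ?thesis by (induction e) (auto simp: mult.assoc dest: reg)
qed

text \<open>
  Quotients of forms by powers of a linear form are forms: a form divisible by \<open>l\<close> leaves remainder
  zero, as no power of \<open>\<beta>\<close> is divisible by \<open>l\<close>. The last clause says that the subtraction of
  degrees is only truncated when the quotient is zero.
\<close>

lemma forms_divide_power:
  fixes a :: "'n::finite \<Rightarrow> 'k::field"
  defines "l \<equiv> linform a"
  assumes l: "l \<in> forms B 1" and j: "a j \<noteq> 0"
    and reg: "\<And>f. l dvd \<beta> * f \<Longrightarrow> l dvd f"
    and rem: "\<And>d q. q \<in> forms B d \<Longrightarrow> remainder B l \<beta> d q"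
  shows "q \<in> forms B d \<Longrightarrow> l ^ n dvd q \<Longrightarrow> \<exists>q'\<in>forms B (d - n). q = l ^ n * q' \<and> (q' \<noteq> 0 \<longrightarrow> n \<le> d)"
proof (induction n arbitrary: q d)
  case (Suc n)
  obtain c r where r: "r \<in> forms B (d - 1)" "d = 0 \<longrightarrow> r = 0" and q: "q = cst c * \<beta> ^ d + l * r"
    using rem[OF Suc.prems(1)] by (auto simp: remainder_def)
  have "l dvd q" using Suc.prems(2) by (auto simp: dvd_def mult.assoc)
  then have "l dvd cst c * \<beta> ^ d * 1" by (simp add: q dvd_add_left_iff)
  then have "c = 0" using dvd_cst_power_mult[OF reg] linear_form_not_dvd_1[OF l] by blast
  then have q: "q = l * r" by (simp add: q)
  obtain g where "l * r = l * (l ^ n * g)" using Suc.prems(2) by (auto simp: q dvd_def mult.assoc)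
  then have "r = l ^ n * g" unfolding l_def by (rule linform_cancel[of a j, OF j])
  then have "l ^ n dvd r" by simp
  then obtain q' where q': "q' \<in> forms B (d - 1 - n)" "r = l ^ n * q'" "q' \<noteq> 0 \<longrightarrow> n \<le> d - 1"
    using Suc.IH[OF r(1)] by blast
  show ?case
  proof (cases "d = 0 \<or> q' = 0")
    case True
    then have "q = l ^ Suc n * 0" using q q'(2) r(2) by auto
    then show ?thesis by (intro bexI[of _ 0]) auto
  next
    case False
    then show ?thesis using q q' by (intro bexI[of _ q']) (auto simp: mult.assoc)
  qed
qed auto

text \<open>
  A product of arrangements of rank at most two, in coordinates: the variables are partitioned into
  blocks of at most two, and each hyperplane involves the variables of one block only.
\<close>

locale blocks =
  fixes blk :: "'n::finite \<Rightarrow> 'n set"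
    and a :: "'h \<Rightarrow> 'n \<Rightarrow> 'k::field" and A :: "'h set"
  assumes blk_self: "i \<in> blk i"
    and blk_eq: "j \<in> blk i \<Longrightarrow> blk j = blk i"
    and blk_card: "card (blk i) \<le> 2"
    and fin: "finite A"
    and supp: "H \<in> A \<Longrightarrow> \<exists>i. a H i \<noteq> 0 \<and> (\<forall>j. a H j \<noteq> 0 \<longrightarrow> j \<in> blk i)"
begin

definition block_basis ::
  "('n \<Rightarrow> nat) \<Rightarrow> ('n \<Rightarrow> 'n \<Rightarrow> ('n, 'k) sym) \<Rightarrow> ('n \<Rightarrow> ('n, 'k) sym) set \<Rightarrow> bool" where
  "block_basis d P M \<longleftrightarrow> vbasis P M \<and>
     (\<forall>k j. P k j \<in> forms (blk k) (d k)) \<and> (\<forall>k j. j \<notin> blk k \<longrightarrow> P k j = 0)"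

text \<open>
  Only the basis vectors with index in the block of \<open>H\<close> have a nonzero value at its form \<open>l\<close>. Divided
  by \<open>l\<^sup>n\<close>, with \<open>n\<close> the old multiplicity, these values are forms \<open>q\<^sub>k\<close>, hence congruent to
  \<open>c\<^sub>k \<beta>\<^sup>e\<close> modulo \<open>l\<close>, where \<open>e\<close> is the degree of \<open>q\<^sub>k\<close>. If all \<open>c\<^sub>k\<close> vanish, the module does not change.
  Otherwise the residue of least degree with \<open>c\<^sub>k \<noteq> 0\<close> divides all others.
\<close>

lemma block_basis_increment:
  assumes P: "block_basis d P (log_vectors a A m)" and H: "H \<in> A"
  shows "\<exists>d P. block_basis d P (log_vectors a A (m(H := Suc (m H))))"
proof -
  let ?M = "log_vectors a A m" and ?M' = "log_vectors a A (m(H := Suc (m H)))"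
  let ?l = "linform (a H)" and ?n = "m H"
  have vb: "vbasis P ?M" and P_forms: "\<And>k j. P k j \<in> forms (blk k) (d k)"
    and P_0: "\<And>k j. j \<notin> blk k \<Longrightarrow> P k j = 0"
    using P by (auto simp: block_basis_def)
  obtain i where i: "a H i \<noteq> 0" and aH: "\<And>j. a H j \<noteq> 0 \<Longrightarrow> j \<in> blk i"
    using supp[OF H] by blast
  let ?B = "blk i"
  have l: "?l \<in> forms ?B 1" using aH by (rule forms_linform)
  obtain \<beta> where reg: "\<And>f. ?l dvd \<beta> * f \<Longrightarrow> ?l dvd f"
    and \<beta>: "?B = {i} \<or> \<beta> \<in> forms ?B 1"
    and rem: "\<And>d q. q \<in> forms ?B d \<Longrightarrow> remainder ?B ?l \<beta> d q"
    using remainder_exists[of ?B "a H", OF blk_card aH i] by blast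
  have off: "form_at (a H) (P k) = 0" if "k \<notin> ?B" for k
  proof -
    have "cst (a H j) * P k j = 0" for j
    proof (cases "a H j = 0")
      case False
      then have "blk j = blk i" using aH blk_eq by blast
      then have "j \<notin> blk k" using that blk_eq[of j k] blk_self[of k] by auto
      then show ?thesis using P_0 by simp
    qed simp
    then show ?thesis by (simp add: form_at_def)
  qed
  have "\<exists>q. form_at (a H) (P k) = ?l ^ ?n * q \<and> (\<exists>c r. q = cst c * \<beta> ^ (d k - ?n) + ?l * r \<and>
      (c \<noteq> 0 \<longrightarrow> k \<in> ?B \<and> ?n \<le> d k))" for k
  proof (cases "k \<in> ?B")
    case True
    have "form_at (a H) (P k) \<in> forms ?B (d k)"
      using P_forms[of k] blk_eq[OF True] by (intro forms_form_at) simp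
    moreover have "?l ^ ?n dvd form_at (a H) (P k)"
      using vbasis_mem[OF vb, of k] H by (simp add: log_vectors_def)
    ultimately obtain q where q: "q \<in> forms ?B (d k - ?n)" "form_at (a H) (P k) = ?l ^ ?n * q"
        "q \<noteq> 0 \<longrightarrow> ?n \<le> d k"
      using forms_divide_power[OF l i reg rem] by blast
    obtain c r where cr: "q = cst c * \<beta> ^ (d k - ?n) + ?l * r"
      using rem[OF q(1)] by (auto simp: remainder_def)
    have "c = 0" if "q = 0"
    proof (rule ccontr)
      assume "c \<noteq> 0"
      have "?l dvd cst c * \<beta> ^ (d k - ?n) * 1 + ?l * r" using that by (simp add: cr)
      then have "?l dvd cst c * \<beta> ^ (d k - ?n) * 1" by (simp add: dvd_add_left_iff)
      then show False
        using dvd_cst_power_mult[OF reg \<open>c \<noteq> 0\<close>] linear_form_not_dvd_1[OF l] by blast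
    qed
    then show ?thesis using q cr True by blast
  next
    case False
    then show ?thesis using off by (intro exI[of _ 0] conjI) auto
  qed
  then obtain q c r where q: "\<And>k. form_at (a H) (P k) = ?l ^ ?n * q k"
    and qcr: "\<And>k. q k = cst (c k) * \<beta> ^ (d k - ?n) + ?l * r k"
    and c: "\<And>k. c k \<noteq> 0 \<Longrightarrow> k \<in> ?B \<and> ?n \<le> d k"
    by metis
  have form_comb: "form_at (a H) (lincomb f P) = ?l ^ ?n * (\<Sum>k\<in>UNIV. f k * q k)" for f
  proof -
    have "form_at (a H) (lincomb f P) = (\<Sum>k\<in>UNIV. f k * form_at (a H) (P k))"
      unfolding lincomb_def form_at_sum
      by (rule sum.cong) (simp_all add: form_at_vscale[unfolded vscale_def])
    then show ?thesis by (simp add: q sum_distrib_left mult.left_commute)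
  qed
  have cancel: "?l ^ n * f = ?l ^ n * g \<Longrightarrow> f = g" for n f g
    by (induction n) (auto simp: mult.assoc dest: linform_cancel[of "a H" i, OF i])
  have "?l ^ Suc ?n dvd ?l ^ ?n * x \<longleftrightarrow> ?l dvd x" for x
  proof
    assume "?l ^ Suc ?n dvd ?l ^ ?n * x"
    then obtain y where "?l ^ ?n * x = ?l ^ ?n * (?l * y)" by (auto simp: dvd_def ac_simps)
    then show "?l dvd x" using cancel by fastforce
  qed (auto simp: dvd_def ac_simps)
  moreover have "p \<in> ?M' \<longleftrightarrow> p \<in> ?M \<and> ?l ^ Suc ?n dvd form_at (a H) p" for p
  proof -
    have A: "A = insert H (A - {H})" using H by auto
    have split: "p \<in> log_vectors a A \<mu> \<longleftrightarrow> ?l ^ \<mu> H dvd form_at (a H) p \<and>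
        (\<forall>G\<in>A - {H}. linform (a G) ^ \<mu> G dvd form_at (a G) p)" for \<mu>
      unfolding log_vectors_def by (subst A) blast
    have "?l ^ ?n dvd x" if "?l ^ Suc ?n dvd x" for x
      using that unfolding power_Suc by (rule dvd_mult_right)
    then show ?thesis by (auto simp: split)
  qed
  ultimately have M': "?M' = {lincomb f P | f. ?l dvd (\<Sum>k\<in>UNIV. f k * q k)}"
    using vb by (auto simp: vbasis_def form_comb) blast
  show ?thesis
  proof (cases "\<forall>k. c k = 0")
    case True
    then have "?l dvd (\<Sum>k\<in>UNIV. f k * q k)" for f
      by (intro dvd_sum dvd_mult) (simp add: qcr)
    then have "?M' = ?M" using vb by (auto simp: M' vbasis_def)
    then show ?thesis using P by auto
  next
    case False
    \<comment> \<open>The degree of \<open>P k\<close> exceeds that of its residue by the old multiplicity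
      whenever \<open>c k \<noteq> 0\<close>, so the residue of least degree belongs to the least \<open>d k\<close>.\<close>
    then obtain k0 where k0: "c k0 \<noteq> 0" and min: "\<And>k. c k \<noteq> 0 \<Longrightarrow> d k0 \<le> d k"
      using ex_has_least_nat[of "\<lambda>k. c k \<noteq> 0" _ d] by blast
    define \<epsilon> where "\<epsilon> k = cst (c k / c k0) * \<beta> ^ (d k - d k0)" for k
    define P' where "P' = (\<lambda>k i. if k = k0 then ?l * P k0 i else P k i - \<epsilon> k * P k0 i)"
    define d' where "d' k = (if k = k0 then Suc (d k0) else d k)" for k
    have blk: "blk k = ?B" if "c k \<noteq> 0" for k using c[OF that] blk_eq by blast
    have "vbasis P' ?M'"
      unfolding M' P'_def
    proof (rule vbasis_step[OF vb])
      show "f = 0" if "?l * f = 0" for f using cancel[of 1 f 0] that by simp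
      show "?l dvd q k - \<epsilon> k * q k0" for k
      proof (cases "c k = 0")
        case False
        then have "\<beta> ^ (d k - d k0) * \<beta> ^ (d k0 - ?n) = \<beta> ^ (d k - ?n)"
          using c[OF k0] min[OF False] by (simp flip: power_add)
        moreover have "cst (c k / c k0) * cst (c k0) = cst (c k)"
          using k0 by (simp flip: cst_mult)
        ultimately have "\<epsilon> k * (cst (c k0) * \<beta> ^ (d k0 - ?n)) = cst (c k) * \<beta> ^ (d k - ?n)"
          unfolding \<epsilon>_def by (metis (no_types, lifting) mult.assoc mult.left_commute)
        then have "q k - \<epsilon> k * q k0 = ?l * (r k - \<epsilon> k * r k0)"
          by (simp add: qcr distrib_left right_diff_distrib mult.left_commute)
        then show ?thesis by simp
      qed (simp add: \<epsilon>_def qcr)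
      show "?l dvd f" if "?l dvd q k0 * f" for f
      proof -
        have "q k0 * f = cst (c k0) * \<beta> ^ (d k0 - ?n) * f + ?l * (r k0 * f)"
          by (simp add: qcr distrib_right mult.assoc)
        then have "?l dvd cst (c k0) * \<beta> ^ (d k0 - ?n) * f"
          using that by (simp add: dvd_add_left_iff)
        then show ?thesis
          by (rule dvd_cst_power_mult[rotated 2]) (use k0 in \<open>auto intro: reg\<close>)
      qed
    qed
    moreover have "P' k j \<in> forms (blk k) (d' k)" for k j
    proof (cases "k = k0")
      case True
      then show ?thesis
        using forms_mult[OF l, of "P k0 j" "d k0"] P_forms[of k0 j] blk[OF k0] by (simp add: P'_def d'_def)
    next
      case kk0: False
      show ?thesis
      proof (cases "c k = 0")
        case True
        then show ?thesis using kk0 P_forms by (simp add: P'_def \<epsilon>_def d'_def)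
      next
        case False
        then have "k \<in> ?B" "k0 \<in> ?B" using c[OF k0] c[OF False] by blast+
        \<comment> \<open>Two different indices in the block rule out the exceptional case \<open>\<beta> = 1\<close>.\<close>
        then have "\<beta> \<in> forms ?B 1" using \<beta> kk0 by auto
        then have "\<beta> ^ (d k - d k0) * P k0 j \<in> forms ?B (d k - d k0 + d k0)"
          using forms_mult[OF forms_power] P_forms[of k0 j] blk[OF k0] by fastforce
        then have "\<epsilon> k * P k0 j \<in> forms ?B (d k)"
          using min[OF False] by (simp add: \<epsilon>_def mult.assoc forms_cst_mult)
        then have "P k j + cst (- 1) * (\<epsilon> k * P k0 j) \<in> forms ?B (d k)"
          using P_forms[of k j] blk[OF False] by (intro forms_add forms_cst_mult) auto
        then show ?thesis using kk0 blk[OF False] by (simp add: P'_def d'_def cst_uminus)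
      qed
    qed
    moreover have "P' k j = 0" if "j \<notin> blk k" for k j
    proof (cases "c k = 0")
      case True
      then show ?thesis using that P_0 k0 by (auto simp: P'_def \<epsilon>_def)
    next
      case False
      then show ?thesis using that P_0[of j k] P_0[of j k0] blk[OF False] blk[OF k0] by (simp add: P'_def)
    qed
    ultimately have "block_basis d' P' ?M'" by (simp add: block_basis_def)
    then show ?thesis by blast
  qed
qed

lemma block_basis_exists: "\<exists>d P. block_basis d P (log_vectors a A m)"
proof (induction "sum m A" arbitrary: m)
  case 0
  then have "log_vectors a A m = UNIV" using fin by (auto simp: log_vectors_def)
  moreover have "block_basis (\<lambda>_. 0) (\<lambda>k j. if j = k then 1 else 0) UNIV"
  proof -
    have "lincomb f (\<lambda>k j. if j = k then 1 else 0) = f" for f :: "'n \<Rightarrow> ('n, 'k) sym"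
    proof
      fix i
      have "lincomb f (\<lambda>k j. if j = k then 1 else 0) i = (\<Sum>k\<in>UNIV. if k = i then f i else 0)"
        unfolding lincomb_def by (rule sum.cong) auto
      then show "lincomb f (\<lambda>k j. if j = k then 1 else 0) i = f i" by simp
    qed
    then show ?thesis using blk_self by (auto simp: block_basis_def vbasis_def)
  qed
  ultimately show ?case by auto
next
  case (Suc n)
  then obtain H where H: "H \<in> A" "m H > 0" by (metis gr0I sum.neutral Zero_neq_Suc)
  let ?m = "m(H := m H - 1)"
  have "sum m A = m H + sum m (A - {H})" using H fin by (simp add: sum.remove)
  moreover have "sum ?m A = m H - 1 + sum m (A - {H})"
    using H fin by (simp add: sum.remove[of A H])
  ultimately have "n = sum ?m A" using Suc.hyps(2) H by simp
  then obtain d P where "block_basis d P (log_vectors a A ?m)" using Suc.hyps(1) by blast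
  from block_basis_increment[OF this H(1)] show ?case using H by simp
qed

theorem free: "free_module vscale (log_vectors a A m)"
  using block_basis_exists[of m] vbasis_free by (auto simp: block_basis_def)

end

section \<open>Arrangements in a vector space\<close>

lemma basis_representation:
  fixes scale :: "'k::field \<Rightarrow> 'v::ab_group_add \<Rightarrow> 'v" and b :: "'n::finite \<Rightarrow> 'v"
  assumes "finite_dimensional_vector_space scale (range b)" and "inj b"
  obtains x where "\<And>v. v = (\<Sum>j\<in>UNIV. scale (x v j) (b j))"
    and "\<And>y. x (\<Sum>j\<in>UNIV. scale (y j) (b j)) = y"
proof -
  interpret finite_dimensional_vector_space scale "range b" by fact
  have sum: "(\<Sum>j\<in>UNIV. scale (y (b j)) (b j)) = (\<Sum>v\<in>range b. scale (y v) v)" for y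
    by (simp add: sum.reindex[OF \<open>inj b\<close>])
  show ?thesis
  proof (rule that[of "\<lambda>v j. representation (range b) v (b j)"])
    show "v = (\<Sum>j\<in>UNIV. scale (representation (range b) v (b j)) (b j))" for v
      unfolding sum by (rule sum_representation_eq[symmetric]) (auto simp: independent_Basis span_Basis)
    show "(\<lambda>k. representation (range b) (\<Sum>j\<in>UNIV. scale (y j) (b j)) (b k)) = y" for y
    proof -
      have "representation (range b) (\<Sum>j\<in>UNIV. scale (y j) (b j)) =
          (\<lambda>v. if v \<in> range b then y (inv b v) else 0)" (is "_ = ?f")
      proof (rule representation_eqI)
        show "finite {v. ?f v \<noteq> 0}" by (rule finite_subset[of _ "range b"]) auto
        have "(\<Sum>v | ?f v \<noteq> 0. scale (?f v) v) = (\<Sum>v\<in>range b. scale (?f v) v)"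
          by (rule sum.mono_neutral_left) auto
        then show "(\<Sum>v | ?f v \<noteq> 0. scale (?f v) v) = (\<Sum>j\<in>UNIV. scale (y j) (b j))"
          by (simp add: sum.reindex[OF \<open>inj b\<close>] inv_f_f[OF \<open>inj b\<close>])
      qed (auto simp: independent_Basis span_Basis split: if_splits)
      then show ?thesis by (simp add: inv_f_f[OF \<open>inj b\<close>])
    qed
  qed
qed

text \<open>
  The matrices expressing two bases by each other are inverse, and rewriting the defining forms in
  the new basis multiplies their coordinates by one of them.
\<close>

lemma free_log_vectors_basis_independent:
  fixes scale :: "'k::field \<Rightarrow> 'v::ab_group_add \<Rightarrow> 'v" and b e :: "'n::finite \<Rightarrow> 'v"
  assumes b: "finite_dimensional_vector_space scale (range b)" "inj b"
    and e: "finite_dimensional_vector_space scale (range e)" "inj e"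
    and lin: "\<And>H. H \<in> A \<Longrightarrow> Vector_Spaces.linear scale (*) (\<alpha> H)"
    and free: "free_module vscale (log_vectors (\<lambda>H i. \<alpha> H (b i)) A m)"
  shows "free_module vscale (log_vectors (\<lambda>H i. \<alpha> H (e i)) A m)"
proof -
  interpret finite_dimensional_vector_space scale "range b" by fact
  obtain x where x: "\<And>v. v = (\<Sum>j\<in>UNIV. scale (x v j) (b j))"
    and x_sum: "\<And>y. x (\<Sum>j\<in>UNIV. scale (y j) (b j)) = y"
    using basis_representation[OF b] by blast
  obtain y where y: "\<And>v. v = (\<Sum>j\<in>UNIV. scale (y v j) (e j))"
    and y_sum: "\<And>z. y (\<Sum>j\<in>UNIV. scale (z j) (e j)) = z"
    using basis_representation[OF e] by blast
  have inverse: "(\<Sum>j\<in>UNIV. x' (e' j) i * y' (b' k) j) = (if i = k then 1 else 0)"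
    if x': "\<And>v. v = (\<Sum>j\<in>UNIV. scale (x' v j) (b' j))"
      and x'_sum: "\<And>y. x' (\<Sum>j\<in>UNIV. scale (y j) (b' j)) = y"
      and y': "\<And>v. v = (\<Sum>j\<in>UNIV. scale (y' v j) (e' j))"
    for x' y' :: "'v \<Rightarrow> 'n \<Rightarrow> 'k" and b' e' i k
  proof -
    let ?z = "\<lambda>i. \<Sum>j\<in>UNIV. x' (e' j) i * y' (b' k) j"
    have "(\<Sum>i\<in>UNIV. scale (?z i) (b' i)) =
        (\<Sum>j\<in>UNIV. scale (y' (b' k) j) (\<Sum>i\<in>UNIV. scale (x' (e' j) i) (b' i)))"
      by (simp add: scale_sum_left scale_sum_right mult.commute) (rule sum.swap)
    also have "\<dots> = b' k" by (simp flip: x' y')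
    also have "\<dots> = (\<Sum>i\<in>UNIV. if i = k then b' k else 0)" by simp
    also have "\<dots> = (\<Sum>i\<in>UNIV. scale (if i = k then 1 else 0) (b' i))"
      by (rule sum.cong) auto
    finally have "x' (\<Sum>i\<in>UNIV. scale (?z i) (b' i)) = x' (\<Sum>i\<in>UNIV. scale (if i = k then 1 else 0) (b' i))"
      by simp
    then have "?z = (\<lambda>i. if i = k then 1 else 0)" by (simp only: x'_sum)
    then show ?thesis by (rule fun_cong)
  qed
  have "inverse_matrices (\<lambda>j i. x (e i) j) (\<lambda>i j. y (b j) i)"
    using inverse[OF x x_sum y] by (simp add: inverse_matrices_def)
  moreover have "inverse_matrices (\<lambda>i j. y (b j) i) (\<lambda>j i. x (e i) j)"
    using inverse[OF y y_sum x] by (simp add: inverse_matrices_def)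
  ultimately have "free_module vscale (log_vectors (\<lambda>H i. \<Sum>j\<in>UNIV. \<alpha> H (b j) * x (e i) j) A m)"
    using free by (rule free_log_vectors_base_change)
  moreover have "(\<Sum>j\<in>UNIV. \<alpha> H (b j) * x (e i) j) = \<alpha> H (e i)" if "H \<in> A" for H i
  proof -
    interpret L: Vector_Spaces.linear scale "(*)" "\<alpha> H" using that by (rule lin)
    have "\<alpha> H (e i) = \<alpha> H (\<Sum>j\<in>UNIV. scale (x (e i) j) (b j))" by (simp flip: x)
    then show ?thesis by (simp add: L.sum L.scale mult.commute)
  qed
  then have "log_vectors (\<lambda>H i. \<Sum>j\<in>UNIV. \<alpha> H (b j) * x (e i) j) A m = log_vectors (\<lambda>H i. \<alpha> H (e i)) A m"
    by (simp add: log_vectors_def cong: ball_cong)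
  ultimately show ?thesis by simp
qed

text \<open>
  Vectors that are dual to the given forms up to scalars are completed to a basis by a basis of the
  common kernel of the forms. In this basis each form is a multiple of a coordinate.
\<close>

lemma adapted_basis:
  fixes scale :: "'k::field \<Rightarrow> 'v::ab_group_add \<Rightarrow> 'v" and b :: "'n::finite \<Rightarrow> 'v"
  assumes b: "finite_dimensional_vector_space scale (range b)" "inj b" and fin: "finite I"
    and lin: "\<And>i. i \<in> I \<Longrightarrow> Vector_Spaces.linear scale (*) (\<alpha> i)"
    and diag: "\<And>i. i \<in> I \<Longrightarrow> \<alpha> i (w i) \<noteq> 0"
    and off: "\<And>i j. i \<in> I \<Longrightarrow> j \<in> I \<Longrightarrow> i \<noteq> j \<Longrightarrow> \<alpha> i (w j) = 0"
  obtains e :: "'n \<Rightarrow> 'v" and \<iota>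
  where "finite_dimensional_vector_space scale (range e)" "inj e" "inj_on \<iota> I"
    and "\<And>i. i \<in> I \<Longrightarrow> e (\<iota> i) = w i"
    and "\<And>i j. i \<in> I \<Longrightarrow> j \<noteq> \<iota> i \<Longrightarrow> \<alpha> i (e j) = 0"
proof -
  interpret finite_dimensional_vector_space scale "range b" by fact
  let ?W = "{v. \<forall>i\<in>I. \<alpha> i v = 0}"
  have \<alpha>_sum: "\<alpha> i (\<Sum>j\<in>J. scale (y j) (v j)) = (\<Sum>j\<in>J. y j * \<alpha> i (v j))"
    and \<alpha>_diff: "\<alpha> i (v' - v'') = \<alpha> i v' - \<alpha> i v''"
    if "i \<in> I" for i v' v'' and J :: "'j set" and y v
  proof -
    interpret L: Vector_Spaces.linear scale "(*)" "\<alpha> i" using that by (rule lin)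
    show "\<alpha> i (\<Sum>j\<in>J. scale (y j) (v j)) = (\<Sum>j\<in>J. y j * \<alpha> i (v j))"
      by (simp add: L.sum L.scale)
    show "\<alpha> i (v' - v'') = \<alpha> i v' - \<alpha> i v''" by (rule L.diff)
  qed
  obtain C where C: "C \<subseteq> ?W" "independent C" "?W \<subseteq> span C"
    by (rule basis_exists[of ?W]) (rule that)
  have finC: "finite C" using C(2) by (rule finiteI_independent)
  have inj_w: "inj_on w I" using diag off by (metis inj_onI)
  let ?E = "w ` I \<union> C"
  have "independent ?E"
  proof
    assume "dependent ?E"
    then obtain y v where y: "v \<in> ?E" "y v \<noteq> 0" "(\<Sum>v\<in>?E. scale (y v) v) = 0"
      using fin finC by (auto simp: dependent_finite)
    have yw: "y (w i) = 0" if "i \<in> I" for i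
    proof -
      have "0 = \<alpha> i (\<Sum>v\<in>?E. scale (y v) v)"
        using \<alpha>_diff[OF that, of 0 0] by (simp add: y(3))
      also have "\<dots> = (\<Sum>v\<in>?E. y v * \<alpha> i v)" by (rule \<alpha>_sum[OF that])
      also have "\<dots> = (\<Sum>v\<in>{w i}. y v * \<alpha> i v)"
      proof (rule sum.mono_neutral_right)
        show "\<forall>v\<in>?E - {w i}. y v * \<alpha> i v = 0"
          using off[OF that] C(1) that by auto
      qed (use fin finC that in auto)
      finally show ?thesis using diag[OF that] by simp
    qed
    have "(\<Sum>v\<in>C. scale (y v) v) = (\<Sum>v\<in>?E. scale (y v) v)"
      by (rule sum.mono_neutral_left) (use fin finC yw in auto)
    then have "y v = 0" if "v \<in> C" for v
      using C(2) finC that y(3) by (auto simp: dependent_finite)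
    then show False using y(1,2) yw by auto
  qed
  moreover have "span ?E = UNIV"
  proof -
    have "v \<in> span ?E" for v
    proof -
      let ?p = "\<Sum>j\<in>I. scale (\<alpha> j v / \<alpha> j (w j)) (w j)"
      have "v - ?p \<in> ?W"
      proof (intro CollectI ballI)
        fix i assume i: "i \<in> I"
        have "(\<Sum>j\<in>I. \<alpha> j v / \<alpha> j (w j) * \<alpha> i (w j)) = (\<Sum>j\<in>{i}. \<alpha> j v / \<alpha> j (w j) * \<alpha> i (w j))"
          by (rule sum.mono_neutral_right) (use fin i off in auto)
        then show "\<alpha> i (v - ?p) = 0" using diag[OF i] by (simp add: \<alpha>_diff[OF i] \<alpha>_sum[OF i])
      qed
      then have "v - ?p \<in> span ?E" using C(3) span_mono[of C ?E] by auto
      moreover have "?p \<in> span ?E" by (intro span_sum span_scale span_base) auto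
      ultimately have "(v - ?p) + ?p \<in> span ?E" by (rule span_add)
      then show ?thesis by simp
    qed
    then show ?thesis by blast
  qed
  moreover have finE: "finite ?E" using fin finC by simp
  ultimately have fd: "finite_dimensional_vector_space scale ?E"
    by unfold_locales auto
  have "card (UNIV :: 'n set) = dim UNIV"
    using card_image[OF \<open>inj b\<close>] by simp
  also have "\<dots> = card ?E"
    using dim_eq_card[of ?E UNIV] \<open>independent ?E\<close> \<open>span ?E = UNIV\<close> by simp
  finally obtain e :: "'n \<Rightarrow> 'v" where e: "bij_betw e UNIV ?E"
    using finite_same_card_bij[of "UNIV :: 'n set" ?E] finE by auto
  then have inj_e: "inj e" and range_e: "range e = ?E" by (auto simp: bij_betw_def)
  define \<iota> where "\<iota> i = inv e (w i)" for i
  have e\<iota>: "e (\<iota> i) = w i" if "i \<in> I" for i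
    using range_e that by (auto simp: \<iota>_def intro!: f_inv_into_f)
  show ?thesis
  proof (rule that[of e \<iota>])
    show "inj_on \<iota> I" using e\<iota> inj_w by (metis inj_on_def)
    show "\<alpha> i (e j) = 0" if "i \<in> I" "j \<noteq> \<iota> i" for i j
    proof -
      have "e j \<in> ?E" using range_e by blast
      moreover have "e j \<noteq> w i" using e\<iota>[OF that(1)] inj_e that(2) by (metis injD)
      ultimately consider x where "x \<in> I" "x \<noteq> i" "e j = w x" | "e j \<in> C" by auto
      then show ?thesis
      proof cases
        case 1
        then show ?thesis using off[OF that(1), of x] by simp
      next
        case 2
        then show ?thesis using C(1) that(1) by auto
      qed
    qed
  qed (use fd range_e inj_e e\<iota> in auto)
qed

lemma minimal_subset:
  assumes "finite S" "Q S"
  obtains T where "T \<subseteq> S" "Q T" "\<And>x. x \<in> T \<Longrightarrow> \<not> Q (T - {x})"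
proof -
  from assms have "\<exists>T\<subseteq>S. Q T \<and> (\<forall>x\<in>T. \<not> Q (T - {x}))"
  proof (induction S rule: finite_psubset_induct)
    case (psubset S)
    show ?case
    proof (cases "\<exists>x\<in>S. Q (S - {x})")
      case True
      then obtain x where x: "x \<in> S" "Q (S - {x})" by blast
      then obtain T where "T \<subseteq> S - {x}" "Q T \<and> (\<forall>x\<in>T. \<not> Q (T - {x}))"
        using psubset.IH[of "S - {x}"] by blast
      then show ?thesis by blast
    qed (use psubset.prems in blast)
  qed
  then show ?thesis using that by blast
qed

text \<open>
  In terms of defining forms: the form of \<open>H\<close> is a linear combination of those of \<open>B\<close> and of no proper
  subset of \<open>B\<close>. So \<open>B\<close> and \<open>H\<close> make up a circuit with at least four elements. Stated with
  intersections, the condition only involves joins of atoms in the intersection lattice.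
\<close>

definition long_circuit :: "'v set set \<Rightarrow> bool" where
  "long_circuit \<A> \<longleftrightarrow>
     (\<exists>H\<in>\<A>. \<exists>B\<subseteq>\<A>. 3 \<le> card B \<and> \<Inter>B \<subseteq> H \<and> (\<forall>G\<in>B. \<not> \<Inter>(B - {G}) \<subseteq> H))"

locale arrangement =
  fixes scale :: "'k::field \<Rightarrow> 'v::ab_group_add \<Rightarrow> 'v" and b :: "'n::finite \<Rightarrow> 'v"
    and \<A> :: "'v set set"
  assumes basis: "finite_dimensional_vector_space scale (range b)" and inj_b: "inj b"
    and central: "central_arrangement scale \<A>"
begin

sublocale finite_dimensional_vector_space scale "range b" by (rule basis)

abbreviation \<alpha> :: "'v set \<Rightarrow> 'v \<Rightarrow> 'k" where
  "\<alpha> \<equiv> defining_form scale"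

lemma finite_arrangement: "finite \<A>"
  using central by (simp add: central_arrangement_def)

lemma hyperplane: "H \<in> \<A> \<Longrightarrow> hyperplane scale H"
  using central by (simp add: central_arrangement_def)

lemma linear_form: "H \<in> \<A> \<Longrightarrow> Vector_Spaces.linear scale (*) (\<alpha> H)"
  by (rule defining_form(1)[OF basis hyperplane])

lemma mem_iff: "H \<in> \<A> \<Longrightarrow> v \<in> H \<longleftrightarrow> \<alpha> H v = 0"
  using defining_form(2)[OF basis hyperplane, of H] by auto

lemma form_scale: "H \<in> \<A> \<Longrightarrow> \<alpha> H (scale c v) = c * \<alpha> H v"
  and form_diff: "H \<in> \<A> \<Longrightarrow> \<alpha> H (v - w) = \<alpha> H v - \<alpha> H w"
proof -
  assume "H \<in> \<A>"
  then interpret L: Vector_Spaces.linear scale "(*)" "\<alpha> H" by (rule linear_form)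
  show "\<alpha> H (scale c v) = c * \<alpha> H v" by (rule L.scale)
  show "\<alpha> H (v - w) = \<alpha> H v - \<alpha> H w" by (rule L.diff)
qed

lemma hyperplane_ne_UNIV: "H \<in> \<A> \<Longrightarrow> H \<noteq> UNIV"
  using hyperplane[of H] by (auto simp: hyperplane_def)

lemma hyperplane_subset_eq:
  assumes "H \<in> \<A>" "G \<in> \<A>" "H \<subseteq> G"
  shows "H = G"
  using hyperplane[OF assms(1)] hyperplane[OF assms(2)] assms(3)
  by (intro subspace_dim_equal) (auto simp: hyperplane_def)

lemma free_multiarrangement_iff:
  assumes "finite_dimensional_vector_space scale (range e)" "inj (e :: 'n \<Rightarrow> 'v)"
  shows "free_multiarrangement scale b \<A> m \<longleftrightarrow> free_module vscale (log_vectors (\<lambda>H i. \<alpha> H (e i)) \<A> m)"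
  unfolding free_multiarrangement_coordinates
proof
  let ?free = "\<lambda>b :: 'n \<Rightarrow> 'v. free_module vscale (log_vectors (\<lambda>H i. \<alpha> H (b i)) \<A> m)"
  show "?free e" if "?free b"
    using linear_form that by (rule free_log_vectors_basis_independent[OF basis inj_b assms])
  show "?free b" if "?free e"
    using linear_form that by (rule free_log_vectors_basis_independent[OF assms basis inj_b])
qed

text \<open>
  By minimality of \<open>B\<close> there are vectors \<open>w G\<close> outside \<open>H\<close> lying in all members of \<open>B\<close> but \<open>G\<close>.
  Normalised by the form of \<open>H\<close>, they extend to a basis in which the circuit has the shape that
  \<open>long_circuit_not_free\<close> asks for.
\<close>

lemma long_circuit_not_totally_free:
  assumes "long_circuit \<A>"
  shows "\<not> totally_free scale b \<A>"
proof -
  obtain H B where H: "H \<in> \<A>" and B: "B \<subseteq> \<A>" "3 \<le> card B" "\<Inter>B \<subseteq> H"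
    and min: "\<And>G. G \<in> B \<Longrightarrow> \<not> \<Inter>(B - {G}) \<subseteq> H"
    using assms by (auto simp: long_circuit_def)
  have "\<exists>w. \<alpha> H w = 1 \<and> (\<forall>G'\<in>B - {G}. \<alpha> G' w = 0)" if G: "G \<in> B" for G
  proof -
    obtain v where v: "v \<in> \<Inter>(B - {G})" "v \<notin> H" using min[OF G] by blast
    have zero: "\<alpha> G' v = 0" if "G' \<in> B - {G}" for G'
      using v(1) that B(1) mem_iff[of G' v] by auto
    have "\<alpha> G' (scale (1 / \<alpha> H v) v) = 0" if "G' \<in> B - {G}" for G'
      using zero[OF that] that B(1) form_scale[of G'] by auto
    moreover have "\<alpha> H (scale (1 / \<alpha> H v) v) = 1"
      using v(2) H by (simp add: form_scale mem_iff)
    ultimately show ?thesis by blast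
  qed
  then obtain w where w: "\<And>G. G \<in> B \<Longrightarrow> \<alpha> H (w G) = 1"
    and w0: "\<And>G G'. G \<in> B \<Longrightarrow> G' \<in> B - {G} \<Longrightarrow> \<alpha> G' (w G) = 0"
    by metis
  have w_ne: "\<alpha> G (w G) \<noteq> 0" if G: "G \<in> B" for G
  proof
    assume "\<alpha> G (w G) = 0"
    then have "\<alpha> G' (w G) = 0" if "G' \<in> B" for G' using w0[OF G] that by (cases "G' = G") auto
    then have "w G \<in> \<Inter>B" using B(1) mem_iff by auto
    then show False using B(3) w[OF G] H mem_iff by auto
  qed
  obtain e :: "'n \<Rightarrow> 'v" and \<iota> where e: "finite_dimensional_vector_space scale (range e)" "inj e"
    and \<iota>: "inj_on \<iota> B" "\<And>G. G \<in> B \<Longrightarrow> e (\<iota> G) = w G"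
    and e0: "\<And>G j. G \<in> B \<Longrightarrow> j \<noteq> \<iota> G \<Longrightarrow> \<alpha> G (e j) = 0"
  proof (rule adapted_basis[OF basis inj_b finite_subset[OF B(1) finite_arrangement], of \<alpha> w])
    show "Vector_Spaces.linear scale (*) (\<alpha> G)" if "G \<in> B" for G
      using that B(1) linear_form by blast
  qed (use w_ne w0 in \<open>auto intro: that\<close>)
  let ?a = "\<lambda>H i. \<alpha> H (e i)"
  have "\<exists>m. (\<forall>H\<in>\<A>. m H > 0) \<and> \<not> free_module vscale (log_vectors ?a \<A> m)"
  proof (rule long_circuit_not_free[OF finite_arrangement B(1,2) H _ \<iota>(1)])
    show "H \<notin> B"
    proof
      assume "H \<in> B"
      have "\<not> B \<subseteq> {H}" using B(2) card_mono[of "{H}" B] by auto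
      then obtain G where "G \<in> B" "G \<noteq> H" by blast
      then show False using min[of G] \<open>H \<in> B\<close> by blast
    qed
    show "?a G = (\<lambda>i. if i = \<iota> G then \<alpha> G (w G) else 0)" if "G \<in> B" for G
      using \<iota>(2)[OF that] e0[OF that] by auto
    show "?a H = (\<lambda>i. if i \<in> \<iota> ` B then 1 else 0)"
    proof
      fix i
      have "e i \<in> G" if "i \<notin> \<iota> ` B" "G \<in> B" for G
        using that e0[of G i] B(1) mem_iff[of G "e i"] by auto
      then have "e i \<in> H" if "i \<notin> \<iota> ` B" using that B(3) by blast
      then show "?a H i = (if i \<in> \<iota> ` B then 1 else 0)"
        using \<iota>(2) w mem_iff[OF H] by auto
    qed
    show "\<exists>j. ?a G j \<noteq> 0" if G: "G \<in> \<A>" for G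
    proof (rule ccontr)
      assume *: "\<not> ?thesis"
      interpret L: Vector_Spaces.linear scale "(*)" "\<alpha> G" using G by (rule linear_form)
      interpret e: finite_dimensional_vector_space scale "range e" by (rule e)
      have "\<alpha> G v = 0" for v
        by (rule L.eq_0_on_span[of "range e"]) (use * e.span_Basis in auto)
      then show False using mem_iff[OF G] hyperplane_ne_UNIV[OF G] by blast
    qed
  qed (use w_ne in auto)
  then show ?thesis using free_multiarrangement_iff[OF e] by (auto simp: totally_free_def)
qed

text \<open>
  The forms of a minimal set \<open>B\<close> with \<open>\<Inter>B = \<Inter>\<A>\<close> are coordinates on which all other forms depend. The
  smallest set \<open>C H \<subseteq> B\<close> of coordinates occurring in the form of \<open>H\<close> has at most two elements, since
  otherwise it would form a long circuit with \<open>H\<close>. Two such pairs sharing exactly one coordinate would give a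
  circuit with four elements, by eliminating the common coordinate. Hence the pairs are the blocks
  of a product decomposition.
\<close>

lemma totally_free_if_no_long_circuit:
  assumes no_long: "\<not> long_circuit \<A>"
  shows "totally_free scale b \<A>"
proof -
  obtain B where B: "B \<subseteq> \<A>" "\<Inter>B = \<Inter>\<A>" and B_min: "\<And>G. G \<in> B \<Longrightarrow> \<Inter>(B - {G}) \<noteq> \<Inter>\<A>"
    by (rule minimal_subset[OF finite_arrangement, of "\<lambda>B. \<Inter>B = \<Inter>\<A>"]) (simp, rule that)
  have "\<exists>u. \<alpha> G u \<noteq> 0 \<and> (\<forall>G'\<in>B - {G}. \<alpha> G' u = 0)" if G: "G \<in> B" for G
  proof -
    have split: "\<Inter>B = \<Inter>(B - {G}) \<inter> G" using G by auto
    have "\<not> \<Inter>(B - {G}) \<subseteq> G"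
    proof
      assume "\<Inter>(B - {G}) \<subseteq> G"
      then have "\<Inter>(B - {G}) = \<Inter>B" unfolding split by (simp add: Int_absorb2)
      then show False using B(2) B_min[OF G] by simp
    qed
    then obtain u where u: "u \<in> \<Inter>(B - {G})" "u \<notin> G" by blast
    have "\<alpha> G' u = 0" if "G' \<in> B - {G}" for G'
      using u(1) that B(1) mem_iff[of G' u] by auto
    then show ?thesis using u(2) G B(1) mem_iff[of G u] by auto
  qed
  then obtain u where u: "\<And>G. G \<in> B \<Longrightarrow> \<alpha> G (u G) \<noteq> 0"
    and u0: "\<And>G G'. G \<in> B \<Longrightarrow> G' \<in> B - {G} \<Longrightarrow> \<alpha> G' (u G) = 0"
    by metis
  obtain e :: "'n \<Rightarrow> 'v" and \<iota> where e: "finite_dimensional_vector_space scale (range e)" "inj e"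
    and \<iota>: "inj_on \<iota> B" "\<And>G. G \<in> B \<Longrightarrow> e (\<iota> G) = u G"
    and e0: "\<And>G j. G \<in> B \<Longrightarrow> j \<noteq> \<iota> G \<Longrightarrow> \<alpha> G (e j) = 0"
  proof (rule adapted_basis[OF basis inj_b finite_subset[OF B(1) finite_arrangement], of \<alpha> u])
    show "Vector_Spaces.linear scale (*) (\<alpha> G)" if "G \<in> B" for G
      using that B(1) linear_form by blast
  qed (use u u0 in \<open>auto intro: that\<close>)
  have "\<exists>C\<subseteq>B. \<Inter>C \<subseteq> H \<and> (\<forall>G\<in>C. \<not> \<Inter>(C - {G}) \<subseteq> H)" if "H \<in> \<A>" for H
  proof -
    have "\<Inter>B \<subseteq> H" using B(2) that by blast
    then obtain C where "C \<subseteq> B" "\<Inter>C \<subseteq> H" "\<And>G. G \<in> C \<Longrightarrow> \<not> \<Inter>(C - {G}) \<subseteq> H"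
      by (rule minimal_subset[OF finite_subset[OF B(1) finite_arrangement], of "\<lambda>C. \<Inter>C \<subseteq> H"]) (rule that)
    then show ?thesis by (intro exI[of _ C]) simp
  qed
  then obtain C where C: "\<And>H. H \<in> \<A> \<Longrightarrow> C H \<subseteq> B" "\<And>H. H \<in> \<A> \<Longrightarrow> \<Inter>(C H) \<subseteq> H"
    and C_min: "\<And>H G. H \<in> \<A> \<Longrightarrow> G \<in> C H \<Longrightarrow> \<not> \<Inter>(C H - {G}) \<subseteq> H"
    by metis
  have C_card: "card (C H) \<le> 2" if "H \<in> \<A>" for H
  proof (rule ccontr)
    assume "\<not> card (C H) \<le> 2"
    then have "long_circuit \<A>"
      unfolding long_circuit_def using that C[OF that] C_min[OF that] B(1)
      by (intro bexI[of _ H] exI[of _ "C H"]) auto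
    then show False using no_long by blast
  qed
  have C_mem: "\<alpha> G v = 0" if "v \<in> \<Inter>D" "G \<in> D" "D \<subseteq> B" for G v D
    using that B(1) mem_iff[of G v] by auto
  have C_zero: "\<alpha> H v = 0" if "H \<in> \<A>" "\<And>G. G \<in> C H \<Longrightarrow> \<alpha> G v = 0" for H v
  proof -
    have "v \<in> G" if "G \<in> C H" for G
      using \<open>G \<in> C H \<Longrightarrow> \<alpha> G v = 0\<close> that C(1)[OF \<open>H \<in> \<A>\<close>] B(1) mem_iff[of G v] by auto
    then show ?thesis using C(2)[OF that(1)] mem_iff[OF that(1), of v] by auto
  qed
  have u_iff: "\<alpha> H (u G) \<noteq> 0 \<longleftrightarrow> G \<in> C H" if H: "H \<in> \<A>" and G: "G \<in> B" for H G
  proof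
    show "G \<in> C H" if "\<alpha> H (u G) \<noteq> 0"
      using C_zero[OF H, of "u G"] u0[OF G] C(1)[OF H] that by blast
  next
    assume GC: "G \<in> C H"
    obtain v where v: "v \<in> \<Inter>(C H - {G})" "v \<notin> H" using C_min[OF H GC] by blast
    let ?v = "v - scale (\<alpha> G v / \<alpha> G (u G)) (u G)"
    have "\<alpha> H ?v = 0"
    proof (rule C_zero[OF H])
      fix G' assume G': "G' \<in> C H"
      then have "G' \<in> B" "G' \<in> \<A>" using C(1)[OF H] B(1) by auto
      then show "\<alpha> G' ?v = 0"
        using u[OF G] u0[OF G, of G'] C_mem[OF v(1), of G'] G' C(1)[OF H]
        by (cases "G' = G") (auto simp: form_diff form_scale)
    qed
    then show "\<alpha> H (u G) \<noteq> 0"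
      using v(2) H by (auto simp: form_diff form_scale mem_iff)
  qed
  have overlap: "C H = C H'"
    if H: "H \<in> \<A>" "card (C H) = 2" and H': "H' \<in> \<A>" "card (C H') = 2" and G: "G \<in> C H" "G \<in> C H'"
    for H H' G
  proof (rule ccontr)
    assume ne: "C H \<noteq> C H'"
    obtain I where I: "C H = {I, G}" "I \<noteq> G"
      using H(2) G(1) by (metis card_2_iff insertE insert_commute singletonD)
    obtain K where K: "C H' = {K, G}" "K \<noteq> G"
      using H'(2) G(2) by (metis card_2_iff insertE insert_commute singletonD)
    have IK: "I \<noteq> K" using ne I K by auto
    have BB: "I \<in> B" "G \<in> B" "K \<in> B" using C(1)[OF H(1)] C(1)[OF H'(1)] I K by auto
    then have AA: "I \<in> \<A>" "G \<in> \<A>" "K \<in> \<A>" using B(1) by auto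
    have val: "\<alpha> I (u G) = 0" "\<alpha> K (u G) = 0" "\<alpha> I (u K) = 0" "\<alpha> K (u I) = 0"
      "\<alpha> H (u G) \<noteq> 0" "\<alpha> H (u I) \<noteq> 0" "\<alpha> H (u K) = 0"
      "\<alpha> H' (u G) \<noteq> 0" "\<alpha> H' (u I) = 0" "\<alpha> H' (u K) \<noteq> 0"
      using u0 u_iff[OF H(1)] u_iff[OF H'(1)] BB I K IK by auto
    have distinct: "H' \<noteq> I" "H' \<noteq> K" using val by auto
    \<comment> \<open>The forms of \<open>H\<close> and \<open>H'\<close> involve exactly the coordinates \<open>I, G\<close> and \<open>K, G\<close>, respectively.
      Eliminating \<open>G\<close> expresses the form of \<open>H\<close> by those of \<open>H'\<close>, \<open>I\<close> and \<open>K\<close>, all of which are needed.\<close>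
    have "\<Inter>{H', I, K} \<subseteq> H"
    proof
      fix v assume "v \<in> \<Inter>{H', I, K}"
      then have v: "\<alpha> H' v = 0" "\<alpha> I v = 0" "\<alpha> K v = 0" using H'(1) AA mem_iff by auto
      let ?t = "\<alpha> G v / \<alpha> G (u G)"
      have "\<alpha> H' (v - scale ?t (u G)) = 0"
        by (rule C_zero[OF H'(1)]) (use K AA v val u[OF BB(2)] in \<open>auto simp: form_diff form_scale\<close>)
      then have "\<alpha> G v = 0" using v val H'(1) u[OF BB(2)] by (auto simp: form_diff form_scale)
      then have "\<alpha> H v = 0" using C_zero[OF H(1)] I v by auto
      then show "v \<in> H" using H(1) mem_iff by simp
    qed
    moreover have "\<not> \<Inter>({H', I, K} - {X}) \<subseteq> H" if X: "X \<in> {H', I, K}" for X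
    proof -
      have wit: ?thesis if v: "\<And>Y. Y \<in> {H', I, K} - {X} \<Longrightarrow> \<alpha> Y v = 0" "\<alpha> H v \<noteq> 0" for v
      proof -
        have "v \<in> Y" if "Y \<in> {H', I, K} - {X}" for Y
          using v(1)[OF that] that H'(1) AA mem_iff[of Y v] by auto
        then show ?thesis using v(2) mem_iff[OF H(1), of v] by auto
      qed
      consider "X = H'" | "X = I" | "X = K" using X by blast
      then show ?thesis
      proof cases
        case 1
        then show ?thesis by (intro wit[of "u G"]) (use val in auto)
      next
        case 2
        then show ?thesis by (intro wit[of "u I"]) (use val in auto)
      next
        case 3
        show ?thesis
          by (rule wit[of "u G - scale (\<alpha> H' (u G) / \<alpha> H' (u K)) (u K)"])
            (use 3 val H(1) H'(1) AA in \<open>auto simp: form_diff form_scale\<close>)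
      qed
    qed
    moreover have "card {H', I, K} = 3" using distinct IK by simp
    ultimately have "long_circuit \<A>"
      unfolding long_circuit_def using H(1) H'(1) AA by (intro bexI[of _ H] exI[of _ "{H', I, K}"]) auto
    then show False using no_long by blast
  qed
  let ?a = "\<lambda>H i. \<alpha> H (e i)"
  have a_iff: "?a H i \<noteq> 0 \<longleftrightarrow> i \<in> \<iota> ` C H" if H: "H \<in> \<A>" for H i
  proof (cases "i \<in> \<iota> ` B")
    case True
    then obtain G where G: "G \<in> B" "i = \<iota> G" by blast
    then have "i \<in> \<iota> ` C H \<longleftrightarrow> G \<in> C H" using \<iota>(1) C(1)[OF H] by (auto dest: inj_onD)
    then show ?thesis using u_iff[OF H G(1)] G \<iota>(2) by simp
  next
    case False
    then have "?a H i = 0" using e0 C(1)[OF H] by (intro C_zero[OF H]) blast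
    then show ?thesis using False C(1)[OF H] by auto
  qed
  define blk where "blk i = insert i (\<Union>{\<iota> ` C H |H. H \<in> \<A> \<and> card (C H) = 2 \<and> i \<in> \<iota> ` C H})" for i
  have blk_pair: "blk i = \<iota> ` C H" if H: "H \<in> \<A>" "card (C H) = 2" "i \<in> \<iota> ` C H" for i H
  proof -
    have "C H' = C H" if H': "H' \<in> \<A>" "card (C H') = 2" "i \<in> \<iota> ` C H'" for H'
    proof -
      obtain G G' where G: "G \<in> C H" "G' \<in> C H'" "\<iota> G = \<iota> G'" using H(3) H'(3) by auto
      then have "G = G'" using \<iota>(1) C(1)[OF H(1)] C(1)[OF H'(1)] by (auto dest: inj_onD)
      then show ?thesis using overlap[OF H'(1,2) H(1,2)] G by auto
    qed
    then show ?thesis unfolding blk_def using H by blast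
  qed
  have blk_cases: "blk i = {i} \<or> (\<exists>H\<in>\<A>. card (C H) = 2 \<and> i \<in> \<iota> ` C H \<and> blk i = \<iota> ` C H)" for i
    using blk_pair by (cases "\<exists>H\<in>\<A>. card (C H) = 2 \<and> i \<in> \<iota> ` C H") (blast, auto simp: blk_def)
  have "blocks blk ?a \<A>"
  proof
    show "i \<in> blk i" for i by (simp add: blk_def)
    show "blk j = blk i" if "j \<in> blk i" for i j
      using blk_cases[of i] blk_pair[of _ j] that by (metis singletonD)
    show "card (blk i) \<le> 2" for i
    proof -
      have "card (\<iota> ` C H) = card (C H)" if "H \<in> \<A>" for H
        using \<iota>(1) C(1)[OF that] by (meson card_image inj_on_subset)
      then show ?thesis using blk_cases[of i] by auto
    qed
    show "finite \<A>" by (rule finite_arrangement)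
    show "\<exists>i. ?a H i \<noteq> 0 \<and> (\<forall>j. ?a H j \<noteq> 0 \<longrightarrow> j \<in> blk i)" if H: "H \<in> \<A>" for H
    proof -
      have "C H \<noteq> {}" using C(2)[OF H] hyperplane_ne_UNIV[OF H] by auto
      then obtain G where G: "G \<in> C H" by blast
      have "\<iota> ` C H \<subseteq> blk (\<iota> G)"
      proof (cases "card (C H) = 2")
        case True
        then show ?thesis using blk_pair[OF H True, of "\<iota> G"] G by simp
      next
        case False
        have "finite (C H)" using C(1)[OF H] B(1) finite_arrangement by (meson finite_subset)
        then have "card (C H) \<noteq> 0" using G by auto
        then have "card (C H) = 1" using False C_card[OF H] by linarith
        then have "C H = {G}" using G by (auto simp: card_1_singleton_iff)
        then show ?thesis by (simp add: blk_def)
      qed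
      then show ?thesis using a_iff[OF H] G by (intro exI[of _ "\<iota> G"]) auto
    qed
  qed
  then have "free_module vscale (log_vectors ?a \<A> m)" for m by (rule blocks.free)
  then show ?thesis using free_multiarrangement_iff[OF e] by (simp add: totally_free_def)
qed

theorem totally_free_iff: "totally_free scale b \<A> \<longleftrightarrow> \<not> long_circuit \<A>"
  using totally_free_if_no_long_circuit long_circuit_not_totally_free by blast

end

section \<open>Long circuits are visible in the intersection lattice\<close>

context arrangement
begin

lemma hyperplane_in_lattice: "H \<in> \<A> \<Longrightarrow> H \<in> intersection_lattice \<A>"
  unfolding intersection_lattice_def by (intro CollectI exI[of _ "{H}"]) auto

lemma Inter_in_lattice:
  assumes "B \<subseteq> \<A>"
  shows "\<Inter>B \<in> intersection_lattice \<A>"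
  using assms finite_subset[OF assms finite_arrangement] by (auto simp: intersection_lattice_def)

lemma UNIV_in_lattice: "UNIV \<in> intersection_lattice \<A>"
  using Inter_in_lattice[of "{}"] by simp

text \<open>
  This describes hyperplanes by the order alone, which an isomorphism preserves. With the lattice
  ordered by inclusion, the atoms appear as the maximal elements below the whole space.
\<close>

lemma lattice_atoms:
  assumes "X \<in> intersection_lattice \<A>"
  shows "X \<in> \<A> \<longleftrightarrow> X \<noteq> UNIV \<and> (\<forall>Y\<in>intersection_lattice \<A>. X \<subseteq> Y \<longrightarrow> Y = X \<or> Y = UNIV)"
    (is "_ \<longleftrightarrow> ?atom")
proof
  assume X: "X \<in> \<A>"
  have "Y = X \<or> Y = UNIV" if Y: "Y \<in> intersection_lattice \<A>" "X \<subseteq> Y" for Y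
  proof -
    obtain B where B: "B \<subseteq> \<A>" "Y = \<Inter>B" using Y(1) by (auto simp: intersection_lattice_def)
    have "H = X" if "H \<in> B" for H
      using hyperplane_subset_eq[OF X, of H] B that Y(2) by auto
    then have "B \<subseteq> {X}" by auto
    then show ?thesis using B(2) by (auto simp: subset_singleton_iff)
  qed
  then show ?atom using hyperplane_ne_UNIV[OF X] by blast
next
  assume atom: ?atom
  obtain B where B: "B \<subseteq> \<A>" "X = \<Inter>B" using assms by (auto simp: intersection_lattice_def)
  then obtain H where H: "H \<in> B" using atom by (cases "B = {}") auto
  then have "X \<subseteq> H" using B(2) by auto
  then have "H = X"
    using atom hyperplane_in_lattice[of H] hyperplane_ne_UNIV[of H] H B(1) by blast
  then show "X \<in> \<A>" using H B(1) by auto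
qed

end

definition lattice_iso :: "'v set set \<Rightarrow> 'w set set \<Rightarrow> ('v set \<Rightarrow> 'w set) \<Rightarrow> bool" where
  "lattice_iso \<A> \<B> \<phi> \<longleftrightarrow> bij_betw \<phi> (intersection_lattice \<A>) (intersection_lattice \<B>) \<and>
     (\<forall>X\<in>intersection_lattice \<A>. \<forall>Y\<in>intersection_lattice \<A>. X \<subseteq> Y \<longleftrightarrow> \<phi> X \<subseteq> \<phi> Y)"

lemma lattice_iso_inverse:
  assumes "lattice_iso \<A> \<B> \<phi>"
  shows "lattice_iso \<B> \<A> (inv_into (intersection_lattice \<A>) \<phi>)"
proof -
  let ?L = "intersection_lattice \<A>" and ?M = "intersection_lattice \<B>"
  have bij: "bij_betw \<phi> ?L ?M" and ord: "\<And>X Y. X \<in> ?L \<Longrightarrow> Y \<in> ?L \<Longrightarrow> X \<subseteq> Y \<longleftrightarrow> \<phi> X \<subseteq> \<phi> Y"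
    using assms by (simp_all add: lattice_iso_def)
  let ?\<psi> = "inv_into ?L \<phi>"
  have bij': "bij_betw ?\<psi> ?M ?L" using bij by (rule bij_betw_inv_into)
  have "X \<subseteq> Y \<longleftrightarrow> ?\<psi> X \<subseteq> ?\<psi> Y" if "X \<in> ?M" "Y \<in> ?M" for X Y
    using ord[OF bij_betw_apply[OF bij' that(1)] bij_betw_apply[OF bij' that(2)]]
    by (simp add: bij_betw_inv_into_right[OF bij] that)
  then show ?thesis using bij' by (simp add: lattice_iso_def)
qed

text \<open>
  An order isomorphism maps atoms to atoms and, as intersections are greatest lower bounds for
  inclusion, commutes with intersections of hyperplanes. These are the only ingredients of a
  long circuit.
\<close>

lemma long_circuit_transport:
  assumes A: "arrangement scaleV (b :: 'n::finite \<Rightarrow> _) \<A>"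
    and B: "arrangement scaleW (c :: 'p::finite \<Rightarrow> _) \<B>"
    and iso: "lattice_iso \<A> \<B> \<phi>" and long: "long_circuit \<A>"
  shows "long_circuit \<B>"
proof -
  interpret A: arrangement scaleV b \<A> by fact
  interpret B: arrangement scaleW c \<B> by fact
  let ?L = "intersection_lattice \<A>" and ?M = "intersection_lattice \<B>"
  have bij: "bij_betw \<phi> ?L ?M" and ord: "\<And>X Y. X \<in> ?L \<Longrightarrow> Y \<in> ?L \<Longrightarrow> \<phi> X \<subseteq> \<phi> Y \<longleftrightarrow> X \<subseteq> Y"
    using iso by (auto simp: lattice_iso_def)
  have mem: "\<phi> X \<in> ?M" if "X \<in> ?L" for X using bij that by (rule bij_betw_apply)
  have onto: "\<exists>X\<in>?L. \<phi> X = Y" if "Y \<in> ?M" for Y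
    using that by (auto simp flip: bij_betw_imp_surj_on[OF bij])
  have inj: "\<phi> X = \<phi> Y \<longleftrightarrow> X = Y" if "X \<in> ?L" "Y \<in> ?L" for X Y
    using bij that by (auto simp: bij_betw_def dest: inj_onD)
  have top: "\<phi> UNIV = UNIV"
    using onto[OF B.UNIV_in_lattice] ord A.UNIV_in_lattice by (metis subset_UNIV top.extremum_uniqueI)
  have atoms: "\<phi> H \<in> \<B>" if H: "H \<in> \<A>" for H
  proof -
    have HL: "H \<in> ?L" using H by (rule A.hyperplane_in_lattice)
    have atom: "H \<noteq> UNIV" "\<And>Y. Y \<in> ?L \<Longrightarrow> H \<subseteq> Y \<Longrightarrow> Y = H \<or> Y = UNIV"
      using H A.lattice_atoms[OF HL] by blast+
    have "\<phi> H \<noteq> UNIV" using atom(1) inj[OF HL A.UNIV_in_lattice] top by simp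
    moreover have "Y = \<phi> H \<or> Y = UNIV" if Y: "Y \<in> ?M" "\<phi> H \<subseteq> Y" for Y
    proof -
      obtain X where X: "X \<in> ?L" "\<phi> X = Y" using onto[OF Y(1)] by blast
      then have "H \<subseteq> X" using Y(2) ord[OF HL] by blast
      then show ?thesis using atom(2)[OF X(1)] X(2) top by auto
    qed
    ultimately show ?thesis using B.lattice_atoms[OF mem[OF HL]] by blast
  qed
  have Inter: "\<phi> (\<Inter>C) = \<Inter>(\<phi> ` C)" if C: "C \<subseteq> \<A>" for C
  proof
    have CL: "\<Inter>C \<in> ?L" using C by (rule A.Inter_in_lattice)
    show "\<phi> (\<Inter>C) \<subseteq> \<Inter>(\<phi> ` C)"
    proof (rule Inter_greatest)
      fix Y assume "Y \<in> \<phi> ` C"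
      then obtain H where "H \<in> C" "Y = \<phi> H" by blast
      then show "\<phi> (\<Inter>C) \<subseteq> Y" using ord[OF CL A.hyperplane_in_lattice, of H] C by auto
    qed
    have "\<Inter>(\<phi> ` C) \<in> ?M" using C atoms by (intro B.Inter_in_lattice) auto
    then obtain X where X: "X \<in> ?L" "\<phi> X = \<Inter>(\<phi> ` C)" using onto by blast
    have "X \<subseteq> H" if "H \<in> C" for H
    proof -
      have "\<phi> X \<subseteq> \<phi> H" using X(2) that by auto
      then show ?thesis using ord[OF X(1) A.hyperplane_in_lattice, of H] that C by auto
    qed
    then have "X \<subseteq> \<Inter>C" by blast
    then show "\<Inter>(\<phi> ` C) \<subseteq> \<phi> (\<Inter>C)" using ord[OF X(1) CL] X(2) by simp
  qed
  have below: "\<Inter>(\<phi> ` C) \<subseteq> \<phi> H \<longleftrightarrow> \<Inter>C \<subseteq> H" if "C \<subseteq> \<A>" "H \<in> \<A>" for C H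
    using ord[OF A.Inter_in_lattice[OF that(1)] A.hyperplane_in_lattice[OF that(2)]] Inter[OF that(1)]
    by simp
  obtain H C where H: "H \<in> \<A>" and C: "C \<subseteq> \<A>" "3 \<le> card C" "\<Inter>C \<subseteq> H"
    and min: "\<And>G. G \<in> C \<Longrightarrow> \<not> \<Inter>(C - {G}) \<subseteq> H"
    using long by (auto simp: long_circuit_def)
  have inj_C: "inj_on \<phi> C" using inj A.hyperplane_in_lattice C(1) by (meson inj_onI subsetD)
  have "\<not> \<Inter>(\<phi> ` C - {G'}) \<subseteq> \<phi> H" if G': "G' \<in> \<phi> ` C" for G'
  proof -
    obtain G where G: "G \<in> C" "G' = \<phi> G" using G' by blast
    then have "\<phi> ` C - {G'} = \<phi> ` (C - {G})"
      using inj_C by (auto dest: inj_onD)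
    then show ?thesis using min[OF G(1)] below[of "C - {G}" H] C(1) H by auto
  qed
  moreover have "3 \<le> card (\<phi> ` C)" using C(2) card_image[OF inj_C] by simp
  moreover have "\<Inter>(\<phi> ` C) \<subseteq> \<phi> H" using below[OF C(1) H] C(3) by blast
  moreover have "\<phi> ` C \<subseteq> \<B>" using atoms C(1) by auto
  ultimately show ?thesis using atoms[OF H] unfolding long_circuit_def by blast
qed

theorem corollary1p3:
  fixes scaleV :: "'k::field \<Rightarrow> 'v::ab_group_add \<Rightarrow> 'v"
    and scaleW :: "'k \<Rightarrow> 'w::ab_group_add \<Rightarrow> 'w"
    and b :: "'n::finite \<Rightarrow> 'v"
    and c :: "'p::finite \<Rightarrow> 'w"
    and \<A> :: "'v set set"
    and \<B> :: "'w set set"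
  assumes "finite_dimensional_vector_space scaleV (range b)" and "inj b"
    and "finite_dimensional_vector_space scaleW (range c)" and "inj c"
    and "central_arrangement scaleV \<A>"
    and "central_arrangement scaleW \<B>"
    and "poset_isomorphic (intersection_lattice \<A>) (\<supseteq>) (intersection_lattice \<B>) (\<supseteq>)"
  shows "totally_free scaleV b \<A> \<longleftrightarrow> totally_free scaleW c \<B>"
proof -
  have A: "arrangement scaleV b \<A>" and B: "arrangement scaleW c \<B>"
    using assms by (simp_all add: arrangement_def)
  obtain \<phi> where "bij_betw \<phi> (intersection_lattice \<A>) (intersection_lattice \<B>)"
    and "\<forall>X\<in>intersection_lattice \<A>. \<forall>Y\<in>intersection_lattice \<A>. X \<supseteq> Y \<longleftrightarrow> \<phi> X \<supseteq> \<phi> Y"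
    using assms(7) unfolding poset_isomorphic_def by (elim exE conjE) (rule that)
  then have \<phi>: "lattice_iso \<A> \<B> \<phi>" by (simp add: lattice_iso_def)
  have "long_circuit \<A> \<longleftrightarrow> long_circuit \<B>"
    using long_circuit_transport[OF A B \<phi>] long_circuit_transport[OF B A lattice_iso_inverse[OF \<phi>]]
    by blast
  then show ?thesis
    using arrangement.totally_free_iff[OF A] arrangement.totally_free_iff[OF B] by simp
qed

end
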